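(* Let $(X_n)_{n\ge1}$ and $(Y_n)_{n\ge0}$ be two sequences of independent identically distributed random variables, independent of each other, such that $X_1$ is uniformly distributed on $\{(1,0),(-1,0),(0,1),(0,-1)\}$ and $Y_0$ is uniformly distributed on $(0,1)^2$. Let $S_0=0$, $S_n=\sum_{k=1}^nX_k$, $M_n=S_n+Y_n$ for $n\ge0$, and for $\varepsilon>0$ let $$\tau_\varepsilon=\min\{m\ge1:|M_m-M_0|<\varepsilon\},$$ where $|\cdot|$ is the Euclidean norm on $\mathbb{R}^2$. Then, almost surely, $$\lim_{\varepsilon\to0}\frac{\log\log\tau_\varepsilon}{-\log\varepsilon}=2.$$ *)

theory Defs
  imports "HOL-Probability.Probability"
begin

definition iid :: "'a measure \<Rightarrow> 'i set \<Rightarrow> ('i \<Rightarrow> 'a \<Rightarrow> 'b::topological_space) \<Rightarrow> bool"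
  where "iid P I Z \<longleftrightarrow>
    prob_space.indep_vars P (\<lambda>_. borel) Z I \<and>
    (\<forall>i\<in>I. \<forall>j\<in>I. distr P borel (Z i) = distr P borel (Z j))"

text \<open>The norm on \<open>real \<times> real\<close> is the Euclidean one.\<close>

definition walk :: "(nat \<Rightarrow> 'a \<Rightarrow> real \<times> real) \<Rightarrow> nat \<Rightarrow> 'a \<Rightarrow> real \<times> real"
  where "walk X n \<omega> = (\<Sum>k=1..n. X k \<omega>)"

definition pert_walk ::
  "(nat \<Rightarrow> 'a \<Rightarrow> real \<times> real) \<Rightarrow> (nat \<Rightarrow> 'a \<Rightarrow> real \<times> real) \<Rightarrow> nat \<Rightarrow> 'a \<Rightarrow> real \<times> real"
  where "pert_walk X Y n \<omega> = walk X n \<omega> + Y n \<omega>"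

definition return_times ::
  "(nat \<Rightarrow> 'a \<Rightarrow> real \<times> real) \<Rightarrow> (nat \<Rightarrow> 'a \<Rightarrow> real \<times> real) \<Rightarrow> real \<Rightarrow> 'a \<Rightarrow> nat set"
  where "return_times X Y \<epsilon> \<omega> =
    {m. 1 \<le> m \<and> norm (pert_walk X Y m \<omega> - pert_walk X Y 0 \<omega>) < \<epsilon>}"

text \<open>The minimum is meaningful only if \<^const>\<open>return_times\<close> is nonempty, so statements about
  \<open>ret_time\<close> have to provide for that.\<close>

definition ret_time ::
  "(nat \<Rightarrow> 'a \<Rightarrow> real \<times> real) \<Rightarrow> (nat \<Rightarrow> 'a \<Rightarrow> real \<times> real) \<Rightarrow> real \<Rightarrow> 'a \<Rightarrow> nat"
  where "ret_time X Y \<epsilon> \<omega> = (LEAST m. m \<in> return_times X Y \<epsilon> \<omega>)"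

end

theory Submission
  imports Defs "HOL-Real_Asymp.Real_Asymp"
begin

text \<open>
  Once \<open>\<epsilon>\<close> is smaller than the distance of \<open>Y\<^sub>0\<close> to the boundary of the unit square, \<open>m\<close> is a return time
  iff \<open>S\<^sub>m = 0\<close> and \<open>|Y\<^sub>m - Y\<^sub>0| < \<epsilon>\<close>. Here \<open>P(S\<^sub>2\<^sub>k = 0)\<close> is of order \<open>1/k\<close>, so that
  \<open>g\<^sub>n = \<Sum>m=1..n. P(S\<^sub>m = 0)\<close> is of order \<open>ln n\<close>, and conditionally on \<open>Y\<^sub>0\<close> a visit to \<open>0\<close> is
  a return with a probability \<open>p\<close> of order \<open>\<epsilon>\<^sup>2\<close>. A union bound gives \<open>P(\<tau> \<le> n) \<le> C \<epsilon>\<^sup>2 ln n\<close>.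
  Conversely, decomposing according to the last return before time \<open>n\<close> gives
  \<open>P(\<tau> > n) (1 + p g\<^sub>n) \<le> 1\<close>. Along \<open>\<epsilon> = 2\<^sup>-\<^sup>k\<close> the choices \<open>ln n = 4\<^sup>k / k\<^sup>2\<close> and \<open>ln n = 4\<^sup>k k\<^sup>2\<close>
  make both probabilities \<open>O(k\<^sup>-\<^sup>2)\<close>, and the Borel--Cantelli lemma applies; monotonicity in \<open>\<epsilon>\<close>
  fills the gaps.
\<close>

subsection \<open>Return probabilities of the one-dimensional walk\<close>

text \<open>The law at time \<open>n\<close> of the simple symmetric walk on the integers started at
  0, obtained by conditioning on the last step. The recursion involves no probability space;
  \<open>prob_increment_eq\<close> ties it to the walk.\<close>

fun pm_walk_prob :: "nat \<Rightarrow> int \<Rightarrow> real" where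
  "pm_walk_prob 0 z = (if z = 0 then 1 else 0)"
| "pm_walk_prob (Suc n) z = (pm_walk_prob n (z - 1) + pm_walk_prob n (z + 1)) / 2"

lemma pm_walk_prob_eq_0_if_far: "\<bar>z\<bar> > int n \<Longrightarrow> pm_walk_prob n z = 0"
  by (induction n arbitrary: z) auto

lemma pm_walk_prob_eq_0_if_parity: "odd (int n + z) \<Longrightarrow> pm_walk_prob n z = 0"
  by (induction n arbitrary: z) auto

text \<open>A path with \<open>j\<close> up-steps among \<open>n\<close> ends at
  \<open>2 * j - n\<close>, and Pascal's rule is the recursion of
  \<open>pm_walk_prob\<close>.\<close>

lemma pm_walk_prob_choose: "pm_walk_prob n (2 * int j - int n) = real (n choose j) / 2 ^ n"
proof (induction n arbitrary: j)
  case 0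
  then show ?case by (cases j) auto
next
  case (Suc n)
  show ?case
  proof (cases j)
    case 0
    have "pm_walk_prob n (- int n - 2) = 0"
      by (rule pm_walk_prob_eq_0_if_far) auto
    then show ?thesis using Suc.IH[of 0] 0 by (simp add: diff_diff_eq add.commute)
  next
    case (Suc i)
    have "2 * int j - int (Suc n) - 1 = 2 * int i - int n"
      "2 * int j - int (Suc n) + 1 = 2 * int j - int n"
      using Suc by auto
    then have "pm_walk_prob (Suc n) (2 * int j - int (Suc n))
      = (real (n choose i) / 2 ^ n + real (n choose j) / 2 ^ n) / 2"
      by (simp only: pm_walk_prob.simps Suc.IH)
    then show ?thesis using Suc by (simp add: field_simps)
  qed
qed

text \<open>This ratio of consecutive central probabilities replaces Stirling's formula: both bounds
  of order 1/k below follow from it by induction.\<close>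

lemma central_pm_walk_prob_Suc:
  "pm_walk_prob (2 * Suc k) 0 = pm_walk_prob (2 * k) 0 * (2 * real k + 1) / (2 * real k + 2)"
proof -
  have u: "pm_walk_prob (2 * k) 0 = real (2 * k choose k) / 4 ^ k" for k
    using pm_walk_prob_choose[of "2 * k" k] by (simp add: power_mult)
  have "Suc k * (2 * Suc k choose Suc k) = (2 * Suc k) * (Suc (2 * k) choose k)"
    using Suc_times_binomial[of k "Suc (2 * k)"] by simp
  moreover have "Suc k * (Suc (2 * k) choose k) = Suc (2 * k) * (2 * k choose k)"
    using Suc_times_binomial[of k "2 * k"] binomial_symmetric[of k "Suc (2 * k)"]
    by (simp add: mult_2)
  ultimately have "Suc k * (2 * Suc k choose Suc k) = 2 * (Suc (2 * k) * (2 * k choose k))"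
    by (simp only: mult.assoc)
  then have "real (Suc k * (2 * Suc k choose Suc k)) = real (2 * (Suc (2 * k) * (2 * k choose k)))"
    by (simp only:)
  then have "real (2 * Suc k choose Suc k) = 2 * (2 * real k + 1) * real (2 * k choose k) / (real k + 1)"
    by (simp only: of_nat_mult of_nat_Suc of_nat_numeral) (simp add: eq_divide_eq algebra_simps)
  then show ?thesis
    unfolding u by (simp only: power_Suc) (simp add: divide_simps, simp add: algebra_simps)
qed

text \<open>The induction step amounts to (2k+1)(2k+3) \<le> (2k+2)^2.\<close>

lemma central_pm_walk_prob_sq_le: "(pm_walk_prob (2 * k) 0)\<^sup>2 \<le> 1 / (2 * real k + 1)"
proof (induction k)
  case 0
  show ?case by simp
next
  case (Suc k)
  let ?x = "real k"
  have "(pm_walk_prob (2 * Suc k) 0)\<^sup>2 = (pm_walk_prob (2 * k) 0)\<^sup>2 * ((2 * ?x + 1) / (2 * ?x + 2))\<^sup>2"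
    unfolding central_pm_walk_prob_Suc by (simp add: power_mult_distrib power_divide)
  also have "\<dots> \<le> 1 / (2 * ?x + 1) * ((2 * ?x + 1) / (2 * ?x + 2))\<^sup>2"
    by (rule mult_right_mono[OF Suc.IH]) simp
  also have "\<dots> = (2 * ?x + 1) / (2 * ?x + 2)\<^sup>2"
    by (simp add: power2_eq_square)
  also have "\<dots> \<le> 1 / (2 * real (Suc k) + 1)"
    by (simp add: divide_simps) (simp add: power2_eq_square algebra_simps)
  finally show ?case .
qed

text \<open>The induction step amounts to 4k(k+1) \<le> (2k+1)^2. Equality at k = 1 determines the
  constant 4.\<close>

lemma central_pm_walk_prob_sq_ge:
  assumes "k \<ge> 1"
  shows "(pm_walk_prob (2 * k) 0)\<^sup>2 \<ge> 1 / (4 * real k)"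
  using assms
proof (induction k rule: dec_induct)
  case base
  show ?case by (simp add: numeral_2_eq_2 power2_eq_square)
next
  case (step k)
  let ?x = "real k"
  have x: "?x \<ge> 1" using step by simp
  have "1 / (4 * real (Suc k)) \<le> 1 / (4 * ?x) * ((2 * ?x + 1) / (2 * ?x + 2))\<^sup>2"
    using x by (simp add: divide_simps) (simp add: power2_eq_square algebra_simps)
  also have "\<dots> \<le> (pm_walk_prob (2 * k) 0)\<^sup>2 * ((2 * ?x + 1) / (2 * ?x + 2))\<^sup>2"
    by (rule mult_right_mono[OF step.IH]) simp
  also have "\<dots> = (pm_walk_prob (2 * Suc k) 0)\<^sup>2"
    unfolding central_pm_walk_prob_Suc by (simp add: power_mult_distrib power_divide)
  finally show ?case .
qed

lemma pm_walk_prob_sq_le: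
  assumes "m \<ge> 1"
  shows "(pm_walk_prob m 0)\<^sup>2 \<le> 1 / real m"
proof (cases "even m")
  case True
  then obtain k where k: "m = 2 * k" by blast
  have "1 / (2 * real k + 1) \<le> 1 / real m" using assms k by (simp add: field_simps)
  with central_pm_walk_prob_sq_le[of k] show ?thesis using k by simp
qed (simp add: pm_walk_prob_eq_0_if_parity)

section \<open>Logarithmic growth of the expected number of visits to the origin\<close>

lemma harm_le_ln: "n \<ge> 1 \<Longrightarrow> harm n \<le> 1 + ln (real n)"
proof (induction n rule: dec_induct)
  case (step n)
  \<comment> \<open>The inequality ln x \<le> x - 1 at x = n/(n+1) bounds 1/(n+1) by an increment of
    the logarithm.\<close>
  have "ln (real n / real (Suc n)) \<le> real n / real (Suc n) - 1"
    using step by (intro ln_le_minus_one) auto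
  then have "inverse (real (Suc n)) \<le> ln (real (Suc n)) - ln (real n)"
    using step by (simp add: ln_div field_simps)
  with step show ?case by (simp add: harm_Suc)
qed (simp add: harm_def)

lemma sum_pm_walk_prob_sq_le:
  assumes "n \<ge> 1"
  shows "(\<Sum>m=1..n. (pm_walk_prob m 0)\<^sup>2) \<le> 1 + ln (real n)"
proof -
  have "(\<Sum>m=1..n. (pm_walk_prob m 0)\<^sup>2) \<le> (\<Sum>m=1..n. 1 / real m)"
    by (intro sum_mono pm_walk_prob_sq_le) simp
  also have "\<dots> = harm n"
    by (simp add: harm_def divide_inverse)
  also have "\<dots> \<le> 1 + ln (real n)"
    by (rule harm_le_ln[OF assms])
  finally show ?thesis .
qed

text \<open>Dropping the odd times loses nothing, as the terms vanish there; the even times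
  contribute at least a quarter of a harmonic sum.\<close>

lemma sum_pm_walk_prob_sq_ge:
  "(\<Sum>m=1..2*N. (pm_walk_prob m 0)\<^sup>2) \<ge> ln (real N + 1) / 4"
proof -
  have "ln (real N + 1) / 4 \<le> harm N / 4"
    using ln_le_harm[of N] by simp
  also have "\<dots> = (\<Sum>k=1..N. 1 / (4 * real k))"
    unfolding harm_def sum_divide_distrib by (intro sum.cong) (auto simp: divide_simps)
  also have "\<dots> \<le> (\<Sum>k=1..N. (pm_walk_prob (2 * k) 0)\<^sup>2)"
    by (intro sum_mono central_pm_walk_prob_sq_ge) auto
  also have "\<dots> = (\<Sum>m\<in>(*) 2 ` {1..N}. (pm_walk_prob m 0)\<^sup>2)"
    by (subst sum.reindex) (auto simp: inj_on_def)
  also have "\<dots> \<le> (\<Sum>m=1..2*N. (pm_walk_prob m 0)\<^sup>2)"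
    by (intro sum_mono2) auto
  finally show ?thesis .
qed

section \<open>From powers of 1/2 to the limit in \<epsilon>\<close>

text \<open>At \<epsilon> = 2^-k the factor \<open>4 ^ k\<close> is \<epsilon>^-2, while dividing or
  multiplying it by k^2 changes the double logarithm only by 2 ln k, which is negligible against k.
  Monotonicity compares a general \<epsilon> with the two neighbouring powers.\<close>

lemma loglog_tendsto_2I:
  fixes \<tau> :: "real \<Rightarrow> nat"
  assumes mono: "\<And>\<epsilon> \<epsilon>'. 0 < \<epsilon> \<Longrightarrow> \<epsilon> \<le> \<epsilon>' \<Longrightarrow> \<tau> \<epsilon>' \<le> \<tau> \<epsilon>"
    and lower: "\<forall>\<^sub>F k in sequentially. exp (4 ^ k / (real k)\<^sup>2) < real (\<tau> ((1/2) ^ k))"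
    and upper: "\<forall>\<^sub>F k in sequentially. real (\<tau> ((1/2) ^ k)) \<le> 2 * exp (4 ^ k * (real k)\<^sup>2) + 2"
  shows "((\<lambda>\<epsilon>. ln (ln (real (\<tau> \<epsilon>))) / (- ln \<epsilon>)) \<longlongrightarrow> 2) (at_right 0)"
proof -
  obtain K where K: "\<And>k. k \<ge> K \<Longrightarrow> exp (4 ^ k / (real k)\<^sup>2) < real (\<tau> ((1/2) ^ k))"
      "\<And>k. k \<ge> K \<Longrightarrow> real (\<tau> ((1/2) ^ k)) \<le> 2 * exp (4 ^ k * (real k)\<^sup>2) + 2" "K \<ge> 1"
    using eventually_conj[OF eventually_conj[OF lower upper] eventually_ge_at_top[of 1]]
    unfolding eventually_sequentially by blast
  \<comment> \<open>Here \<epsilon> = 2^-t. The bounds \<open>lo\<close> and \<open>hi\<close> are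
    written in \<open>t\<close> instead of its integer part \<open>k\<close>, so that their limits
    are those of elementary functions of \<epsilon>.\<close>
  define t where "t = (\<lambda>\<epsilon>::real. - ln \<epsilon> / ln 2)"
  define lo where "lo = (\<lambda>\<epsilon>::real. ((t \<epsilon> - 1) * ln 4 - 2 * ln (t \<epsilon>)) / (- ln \<epsilon>))"
  define hi where "hi = (\<lambda>\<epsilon>::real. ((t \<epsilon> + 1) * ln 4 + 2 * ln (t \<epsilon> + 1) + ln 2) / (- ln \<epsilon>))"
  have bounds: "lo \<epsilon> \<le> ln (ln (real (\<tau> \<epsilon>))) / (- ln \<epsilon>) \<and> ln (ln (real (\<tau> \<epsilon>))) / (- ln \<epsilon>) \<le> hi \<epsilon>"
    if \<epsilon>: "0 < \<epsilon>" "\<epsilon> < (1/2) ^ K" for \<epsilon>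
  proof -
    define k where "k = nat \<lfloor>t \<epsilon>\<rfloor>"
    have l2: "ln 2 > (0::real)" by simp
    have "ln \<epsilon> < ln ((1/2) ^ K)" using \<epsilon> by (subst ln_less_cancel_iff) auto
    then have "real K * ln 2 < - ln \<epsilon>" by (simp add: ln_realpow ln_div)
    moreover have "0 \<le> real K * ln 2" by simp
    ultimately have pos: "- ln \<epsilon> > 0" by linarith
    have tK: "real K < t \<epsilon>" using l2 \<open>real K * ln 2 < - ln \<epsilon>\<close>
      by (simp add: t_def field_simps)
    have kK: "k \<ge> K" unfolding k_def using tK by linarith
    then have k1: "k \<ge> 1" using K(3) by simp
    have kt: "real k \<le> t \<epsilon>" "t \<epsilon> < real k + 1" unfolding k_def using tK by linarith+
    have "ln \<epsilon> \<le> ln ((1/2) ^ k)" using kt l2 by (simp add: t_def field_simps ln_realpow ln_div)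
    then have e1: "\<epsilon> \<le> (1/2) ^ k" using \<epsilon> by (subst (asm) ln_le_cancel_iff) auto
    have "ln ((1/2) ^ Suc k) \<le> ln \<epsilon>" using kt l2 by (simp add: t_def field_simps ln_realpow ln_div ln_mult)
    then have e2: "(1/2) ^ Suc k \<le> \<epsilon>" using \<epsilon> by (subst (asm) ln_le_cancel_iff) auto
    have a0: "4 ^ k / (real k)\<^sup>2 > 0" using k1 by simp
    have "exp (4 ^ k / (real k)\<^sup>2) < real (\<tau> \<epsilon>)"
      using K(1)[OF kK] mono[OF \<epsilon>(1) e1] by linarith
    then have tp: "real (\<tau> \<epsilon>) > 0"
      by (rule less_trans[OF exp_gt_zero])
    with \<open>exp (4 ^ k / (real k)\<^sup>2) < real (\<tau> \<epsilon>)\<close> have l1: "4 ^ k / (real k)\<^sup>2 < ln (real (\<tau> \<epsilon>))"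
      using ln_less_cancel_iff[of "exp (4 ^ k / (real k)\<^sup>2)" "real (\<tau> \<epsilon>)"]
      by simp
    have "(t \<epsilon> - 1) * ln 4 - 2 * ln (t \<epsilon>) \<le> real k * ln 4 - 2 * ln (real k)"
    proof -
      have "(t \<epsilon> - 1) * ln 4 \<le> real k * ln 4" using kt by (intro mult_right_mono) auto
      moreover have "real k * ln 4 - 2 * ln (real k) \<ge> real k * ln 4 - 2 * ln (t \<epsilon>)"
        using kt k1 by simp
      ultimately show ?thesis by linarith
    qed
    also have "\<dots> = ln (4 ^ k / (real k)\<^sup>2)"
      using k1 by (simp add: ln_div ln_realpow)
    also have "\<dots> \<le> ln (ln (real (\<tau> \<epsilon>)))" using l1 a0 by (subst ln_le_cancel_iff) auto
    finally have A: "(t \<epsilon> - 1) * ln 4 - 2 * ln (t \<epsilon>) \<le> ln (ln (real (\<tau> \<epsilon>)))" .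
    \<comment> \<open>The upper bound uses the next power, 2^-(k+1) \<le> \<epsilon>. As
      \<open>exp a\<close> is at least 4, its square absorbs the factor 2 and the summand 2, at the
      price of only \<open>ln 2\<close> after two logarithms.\<close>
    define a where "a = (4::real) ^ Suc k * (real (Suc k))\<^sup>2"
    have "a \<ge> 4 * 1"
      unfolding a_def by (intro mult_mono) (auto simp: power_increasing one_le_power)
    then have a4: "a \<ge> 4" by simp
    have ea: "exp a \<ge> 4" using exp_ge_add_one_self[of a] a4 by linarith
    have "real (\<tau> \<epsilon>) \<le> real (\<tau> ((1/2) ^ Suc k))"
      using mono[OF _ e2] by simp
    also have "\<dots> \<le> 2 * exp a + 2"
      unfolding a_def using kK by (intro K(2)) simp
    also have "\<dots> \<le> exp a * exp a"
      using ea mult_right_mono[of 4 "exp a" "exp a"] by linarith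
    also have "\<dots> = exp (2 * a)" by (simp flip: exp_add)
    finally have "real (\<tau> \<epsilon>) \<le> exp (2 * a)" .
    with tp have "ln (real (\<tau> \<epsilon>)) \<le> 2 * a"
      using ln_le_cancel_iff[of "real (\<tau> \<epsilon>)" "exp (2 * a)"] by simp
    then have "ln (ln (real (\<tau> \<epsilon>))) \<le> ln (2 * a)" using l1 a0 a4 by (subst ln_le_cancel_iff) auto
    also have "\<dots> = real (Suc k) * ln 4 + 2 * ln (real (Suc k)) + ln 2"
      unfolding a_def by (simp add: ln_mult ln_realpow del: power_Suc)
    also have "\<dots> \<le> (t \<epsilon> + 1) * ln 4 + 2 * ln (t \<epsilon> + 1) + ln 2"
    proof -
      have "real (Suc k) * ln 4 \<le> (t \<epsilon> + 1) * ln 4" using kt by (intro mult_right_mono) auto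
      moreover have "ln (real (Suc k)) \<le> ln (t \<epsilon> + 1)"
        using kt k1 by simp
      ultimately show ?thesis by linarith
    qed
    finally have B: "ln (ln (real (\<tau> \<epsilon>))) \<le> (t \<epsilon> + 1) * ln 4 + 2 * ln (t \<epsilon> + 1) + ln 2" .
    show ?thesis unfolding lo_def hi_def using A B pos by (intro conjI divide_right_mono) auto
  qed
  \<comment> \<open>Since ln 4 = 2 ln 2, the leading term of both bounds is -2 ln \<epsilon>. The
    limits are proved with an arbitrary \<open>c > 0\<close> in place of ln 2.\<close>
  have ln4: "ln (4::real) = 2 * ln 2" using ln_realpow[of 2 2] by simp
  have *: "((\<lambda>\<epsilon>::real. ((- ln \<epsilon> / c - 1) * (2 * c) - 2 * ln (- ln \<epsilon> / c)) / (- ln \<epsilon>)) \<longlongrightarrow> 2) (at_right 0)"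
    if "c > 0" for c :: real
    using that by real_asymp
  have lo: "(lo \<longlongrightarrow> 2) (at_right 0)"
    unfolding lo_def t_def ln4 by (rule *) simp
  have *: "((\<lambda>\<epsilon>::real. ((- ln \<epsilon> / c + 1) * (2 * c) + 2 * ln (- ln \<epsilon> / c + 1) + c) / (- ln \<epsilon>)) \<longlongrightarrow> 2) (at_right 0)"
    if "c > 0" for c :: real
    using that by real_asymp
  have hi: "(hi \<longlongrightarrow> 2) (at_right 0)"
    unfolding hi_def t_def ln4 by (rule *) simp
  have ev: "\<forall>\<^sub>F \<epsilon> in at_right 0. 0 < \<epsilon> \<and> \<epsilon> < (1/2::real) ^ K"
    unfolding eventually_at_right_field by (intro exI[of _ "(1/2) ^ K"]) auto
  show ?thesis
    by (rule tendsto_sandwich[OF _ _ lo hi]; rule eventually_mono[OF ev]) (use bounds in auto)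
qed

subsection \<open>Independent families\<close>

text \<open>Merging the two families into one over a disjoint sum makes any two disjoint blocks of
  steps and perturbations independent. A finite intersection splits into an event of each family:
  \<open>XY\<close> separates the two events, and each then factors within its own family.\<close>

lemma (in prob_space) indep_vars_case_sum:
  assumes X: "indep_vars (\<lambda>_. N) X I" and Y: "indep_vars (\<lambda>_. N) Y J"
    and XY: "indep_var (Pi\<^sub>M I (\<lambda>_. N)) (\<lambda>\<omega>. \<lambda>i\<in>I. X i \<omega>) (Pi\<^sub>M J (\<lambda>_. N)) (\<lambda>\<omega>. \<lambda>j\<in>J. Y j \<omega>)"
  shows "indep_vars (\<lambda>_. N) (case_sum X Y) (I <+> J)"
  unfolding indep_vars_def2
proof (intro conjI ballI indep_setsI)
  have rvX: "random_variable N (X i)" if "i \<in> I" for i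
    using X that by (auto simp: indep_vars_def)
  have rvY: "random_variable N (Y i)" if "i \<in> J" for i
    using Y that by (auto simp: indep_vars_def)
  show rv: "random_variable N (case_sum X Y i)" if "i \<in> I <+> J" for i
    using that rvX rvY by auto
  show "{case_sum X Y i -` A \<inter> space M |A. A \<in> sets N} \<subseteq> events" if "i \<in> I <+> J" for i
    using rv[OF that] by (auto intro: measurable_sets)
  fix A L assume L: "L \<noteq> {}" "L \<subseteq> I <+> J" "finite L"
    "\<forall>j\<in>L. A j \<in> {case_sum X Y j -` A \<inter> space M |A. A \<in> sets N}"
  have "\<forall>j\<in>L. \<exists>B. B \<in> sets N \<and> A j = case_sum X Y j -` B \<inter> space M"
    using L(4) by blast
  then obtain B where B: "\<And>j. j \<in> L \<Longrightarrow> B j \<in> sets N" "\<And>j. j \<in> L \<Longrightarrow> A j = case_sum X Y j -` B j \<inter> space M"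
    by metis
  define L1 where "L1 = Inl -` L"
  define L2 where "L2 = Inr -` L"
  have fin: "finite L1" "finite L2"
    unfolding L1_def L2_def using L(3) by (auto intro!: finite_vimageI)
  have sub: "L1 \<subseteq> I" "L2 \<subseteq> J" unfolding L1_def L2_def using L(2) by auto
  have Leq: "L = Inl ` L1 \<union> Inr ` L2"
  proof (rule set_eqI)
    show "z \<in> L \<longleftrightarrow> z \<in> Inl ` L1 \<union> Inr ` L2" for z
      by (cases z) (auto simp: L1_def L2_def)
  qed
  define C1 where "C1 = {f \<in> space (Pi\<^sub>M I (\<lambda>_. N)). \<forall>i\<in>L1. f i \<in> B (Inl i)}"
  define C2 where "C2 = {f \<in> space (Pi\<^sub>M J (\<lambda>_. N)). \<forall>i\<in>L2. f i \<in> B (Inr i)}"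
  have B1: "B (Inl i) \<in> sets N" if "i \<in> L1" for i using that B(1) by (auto simp: L1_def)
  have B2: "B (Inr i) \<in> sets N" if "i \<in> L2" for i using that B(1) by (auto simp: L2_def)
  have C1: "C1 \<in> sets (Pi\<^sub>M I (\<lambda>_. N))"
    unfolding C1_def
  proof (rule sets.sets_Collect_finite_All[OF _ fin(1)])
    fix i assume i: "i \<in> L1"
    then have "i \<in> I" using sub by auto
    from measurable_sets[OF measurable_component_singleton[OF this] B1[OF i]]
    show "{f \<in> space (Pi\<^sub>M I (\<lambda>_. N)). f i \<in> B (Inl i)} \<in> sets (Pi\<^sub>M I (\<lambda>_. N))"
      by (simp add: vimage_def Int_def conj_commute)
  qed
  have C2: "C2 \<in> sets (Pi\<^sub>M J (\<lambda>_. N))"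
    unfolding C2_def
  proof (rule sets.sets_Collect_finite_All[OF _ fin(2)])
    fix i assume i: "i \<in> L2"
    then have "i \<in> J" using sub by auto
    from measurable_sets[OF measurable_component_singleton[OF this] B2[OF i]]
    show "{f \<in> space (Pi\<^sub>M J (\<lambda>_. N)). f i \<in> B (Inr i)} \<in> sets (Pi\<^sub>M J (\<lambda>_. N))"
      by (simp add: vimage_def Int_def conj_commute)
  qed
  have e1: "(\<lambda>\<omega>. \<lambda>i\<in>I. X i \<omega>) -` C1 \<inter> space M = {\<omega>\<in>space M. \<forall>i\<in>L1. X i \<omega> \<in> B (Inl i)}"
    unfolding C1_def space_PiM using sub rvX by (auto dest: measurable_space)
  have e2: "(\<lambda>\<omega>. \<lambda>i\<in>J. Y i \<omega>) -` C2 \<inter> space M = {\<omega>\<in>space M. \<forall>i\<in>L2. Y i \<omega> \<in> B (Inr i)}"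
    unfolding C2_def space_PiM using sub rvY by (auto dest: measurable_space)
  \<comment> \<open>The empty index set is included, because a nonempty \<open>L\<close> may meet
    only one of the two families.\<close>
  have p: "prob {\<omega>\<in>space M. \<forall>i\<in>K. Z i \<omega> \<in> D i} = (\<Prod>i\<in>K. prob (Z i -` D i \<inter> space M))"
    if "indep_vars (\<lambda>_. N) Z I'" "K \<subseteq> I'" "finite K" "\<And>i. i \<in> K \<Longrightarrow> D i \<in> sets N" for Z K D and I' :: "'z set"
  proof (cases "K = {}")
    case False
    then have "{\<omega>\<in>space M. \<forall>i\<in>K. Z i \<omega> \<in> D i} = (\<Inter>i\<in>K. Z i -` D i \<inter> space M)" by auto
    with indep_varsD[OF that(1) False that(3,2), of D] that(4) show ?thesis by simp
  qed (simp add: prob_space)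
  have "(\<Inter>j\<in>L. A j) = (\<lambda>\<omega>. (\<lambda>i\<in>I. X i \<omega>, \<lambda>j\<in>J. Y j \<omega>)) -` (C1 \<times> C2) \<inter> space M"
  proof -
    have "(\<lambda>\<omega>. (\<lambda>i\<in>I. X i \<omega>, \<lambda>j\<in>J. Y j \<omega>)) -` (C1 \<times> C2) \<inter> space M
      = {\<omega>\<in>space M. \<forall>i\<in>L1. X i \<omega> \<in> B (Inl i)} \<inter> {\<omega>\<in>space M. \<forall>i\<in>L2. Y i \<omega> \<in> B (Inr i)}"
      unfolding e1[symmetric] e2[symmetric] by blast
    also have "\<dots> = {\<omega>\<in>space M. \<forall>j\<in>L. case_sum X Y j \<omega> \<in> B j}"
      unfolding Leq ball_Un by auto
    also have "\<dots> = (\<Inter>j\<in>L. A j)"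
      using L(1) B(2) by auto
    finally show ?thesis by simp
  qed
  then have "prob (\<Inter>j\<in>L. A j) =
    prob {\<omega>\<in>space M. \<forall>i\<in>L1. X i \<omega> \<in> B (Inl i)} * prob {\<omega>\<in>space M. \<forall>i\<in>L2. Y i \<omega> \<in> B (Inr i)}"
    using indep_varD[OF XY C1 C2] e1 e2 by simp
  also have "\<dots> = (\<Prod>i\<in>L1. prob (A (Inl i))) * (\<Prod>i\<in>L2. prob (A (Inr i)))"
    using p[OF X sub(1) fin(1), of "\<lambda>i. B (Inl i)"] p[OF Y sub(2) fin(2), of "\<lambda>i. B (Inr i)"] B1 B2 B(2)
    by (simp add: Leq)
  also have "\<dots> = (\<Prod>j\<in>L. prob (A j))"
    unfolding Leq using fin by (subst prod.union_disjoint) (auto simp: prod.reindex inj_on_def)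
  finally show "prob (\<Inter>j\<in>L. A j) = (\<Prod>j\<in>L. prob (A j))" .
qed

text \<open>Injectivity makes the singleton blocks \<open>{f j}\<close> disjoint. The lemma is
  applied to shifts of time.\<close>

lemma (in prob_space) indep_vars_reindex_inj:
  assumes "indep_vars (\<lambda>_. N) Z I" "inj_on f J" "f ` J \<subseteq> I"
  shows "indep_vars (\<lambda>_. N) (\<lambda>j. Z (f j)) J"
proof -
  have "indep_vars (\<lambda>j. Pi\<^sub>M {f j} (\<lambda>_. N)) (\<lambda>j \<omega>. \<lambda>i\<in>{f j}. Z i \<omega>) J"
    using assms by (intro indep_vars_restrict[OF assms(1)]) (auto simp: disjoint_family_on_def inj_on_def)
  then have "indep_vars (\<lambda>_. N) (\<lambda>j \<omega>. (\<lambda>h. h (f j)) (\<lambda>i\<in>{f j}. Z i \<omega>)) J"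
    by (rule indep_vars_compose2) simp
  then show ?thesis by simp
qed

section \<open>Uniform laws on the square and on the four steps\<close>

text \<open>The upper bound is the area of the square of side 2 \<epsilon> centred at
  \<open>y\<close>. For the lower bound a square of side \<epsilon>/2 fits into both the ball and
  the unit square, however close \<open>y\<close> is to the boundary.\<close>

lemma measure_uniform_unit_square_ball:
  fixes y :: "real \<times> real"
  assumes y: "y \<in> {0<..<1} \<times> {0<..<1}" and \<epsilon>: "0 < \<epsilon>" "\<epsilon> \<le> 1"
  defines "p \<equiv> measure (uniform_measure lborel ({0<..<1} \<times> {0<..<1})) (ball y \<epsilon>)"
  shows "\<epsilon>\<^sup>2 / 4 \<le> p" "p \<le> 4 * \<epsilon>\<^sup>2"
proof -
  let ?S = "{0<..<1} \<times> {0<..<1} :: (real \<times> real) set"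
  obtain a b where ab: "y = (a, b)" "0 < a" "a < 1" "0 < b" "b < 1" using y by auto
  have times: "emeasure lborel (A \<times> B) = emeasure lborel A * emeasure lborel B"
    if "A \<in> sets borel" "B \<in> sets borel" for A B :: "real set"
    using that by (simp add: lborel_prod[symmetric] lborel.emeasure_pair_measure_Times)
  have opS: "open ?S" by (intro open_Times) auto
  have S1: "emeasure lborel ?S = 1" by (simp add: times)
  have e: "emeasure (uniform_measure lborel ?S) (ball y \<epsilon>) = emeasure lborel (?S \<inter> ball y \<epsilon>)"
    using opS by (subst emeasure_uniform_measure) (auto simp: S1 divide_ennreal_def)
  \<comment> \<open>The interval has \<open>c\<close> as an endpoint and extends from there across
    the middle side of (0,1); it fits because \<epsilon> \<le> 1.\<close>
  have quarter: "\<exists>l. 0 \<le> l \<and> l + \<epsilon> / 2 \<le> 1 \<and> (\<forall>x. l < x \<and> x < l + \<epsilon> / 2 \<longrightarrow> \<bar>c - x\<bar> < \<epsilon> / 2)"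
    if "0 < c" "c < 1" for c
  proof (cases "c \<le> 1 / 2")
    case True
    with that \<epsilon> show ?thesis by (intro exI[of _ c]) auto
  next
    case False
    with that \<epsilon> show ?thesis by (intro exI[of _ "c - \<epsilon> / 2"]) auto
  qed
  obtain l1 where l1: "0 \<le> l1" "l1 + \<epsilon> / 2 \<le> 1" "\<And>x. l1 < x \<Longrightarrow> x < l1 + \<epsilon> / 2 \<Longrightarrow> \<bar>a - x\<bar> < \<epsilon> / 2"
    using quarter[of a] ab by blast
  obtain l2 where l2: "0 \<le> l2" "l2 + \<epsilon> / 2 \<le> 1" "\<And>x. l2 < x \<Longrightarrow> x < l2 + \<epsilon> / 2 \<Longrightarrow> \<bar>b - x\<bar> < \<epsilon> / 2"
    using quarter[of b] ab by blast
  have "{l1<..<l1 + \<epsilon> / 2} \<times> {l2<..<l2 + \<epsilon> / 2} \<subseteq> ?S \<inter> ball y \<epsilon>"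
  proof
    fix z assume "z \<in> {l1<..<l1 + \<epsilon> / 2} \<times> {l2<..<l2 + \<epsilon> / 2}"
    then obtain u v where z: "z = (u, v)" and uv: "l1 < u" "u < l1 + \<epsilon> / 2" "l2 < v" "v < l2 + \<epsilon> / 2" by auto
    have "dist y (u, v) \<le> \<bar>a - u\<bar> + \<bar>b - v\<bar>"
      using sqrt_sum_squares_le_sum_abs[of "a - u" "b - v"] by (simp add: ab dist_Pair_Pair dist_real_def)
    also have "\<dots> < \<epsilon>" using l1(3)[OF uv(1,2)] l2(3)[OF uv(3,4)] by linarith
    finally show "z \<in> ?S \<inter> ball y \<epsilon>"
      using uv l1(1,2) l2(1,2) by (auto simp: z)
  qed
  then have "emeasure lborel ({l1<..<l1 + \<epsilon> / 2} \<times> {l2<..<l2 + \<epsilon> / 2}) \<le> emeasure lborel (?S \<inter> ball y \<epsilon>)"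
    using opS by (intro emeasure_mono) auto
  then have lo: "ennreal (\<epsilon>\<^sup>2 / 4) \<le> emeasure lborel (?S \<inter> ball y \<epsilon>)"
    using \<epsilon> by (simp add: times power2_eq_square flip: ennreal_mult)
  have "?S \<inter> ball y \<epsilon> \<subseteq> {a - \<epsilon><..<a + \<epsilon>} \<times> {b - \<epsilon><..<b + \<epsilon>}"
  proof
    fix z assume "z \<in> ?S \<inter> ball y \<epsilon>"
    then have "dist y z < \<epsilon>" by simp
    then have "dist a (fst z) < \<epsilon>" "dist b (snd z) < \<epsilon>"
      using dist_fst_le[of y z] dist_snd_le[of y z] ab(1) by auto
    then show "z \<in> {a - \<epsilon><..<a + \<epsilon>} \<times> {b - \<epsilon><..<b + \<epsilon>}"
      by (cases z) (auto simp: dist_real_def)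
  qed
  then have "emeasure lborel (?S \<inter> ball y \<epsilon>) \<le> emeasure lborel ({a - \<epsilon><..<a + \<epsilon>} \<times> {b - \<epsilon><..<b + \<epsilon>})"
    by (intro emeasure_mono) (auto intro!: borel_open open_Times)
  then have hi: "emeasure lborel (?S \<inter> ball y \<epsilon>) \<le> ennreal (4 * \<epsilon>\<^sup>2)"
    using \<epsilon> by (simp add: times power2_eq_square flip: ennreal_mult)
  have eq: "emeasure lborel (?S \<inter> ball y \<epsilon>) = ennreal p"
    unfolding p_def e[symmetric] using hi by (intro emeasure_eq_ennreal_measure) (auto simp: e top_unique)
  have "p \<ge> 0" unfolding p_def by simp
  with lo hi show "\<epsilon>\<^sup>2 / 4 \<le> p" "p \<le> 4 * \<epsilon>\<^sup>2"
    unfolding eq by auto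
qed

text \<open>Pushing forward along the identity only replaces the subsets of \<open>T\<close> by the
  Borel sets as sigma-algebra; singletons are Borel in a T1 space.\<close>

lemma measure_distr_uniform_count_measure:
  fixes e :: "'b::t1_space"
  assumes "finite T" "e \<in> T"
  shows "measure (distr (uniform_count_measure T) borel (\<lambda>x. x)) {e} = 1 / card T"
proof -
  have "measure (distr (uniform_count_measure T) borel (\<lambda>x. x)) {e} = measure (uniform_count_measure T) {e}"
    using assms(2)
    by (subst measure_distr) (auto simp: space_uniform_count_measure sets_uniform_count_measure measurable_def)
  then show ?thesis
    using assms by (simp add: measure_uniform_count_measure)
qed

lemma AE_distr_uniform_count_measure:
  fixes T :: "'b::t1_space set"
  assumes "finite T"
  shows "AE x in distr (uniform_count_measure T) borel (\<lambda>x. x). x \<in> T"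
proof -
  have "T \<in> sets borel" using assms by (intro borel_closed finite_imp_closed)
  then show ?thesis
    by (subst AE_distr_iff)
      (auto simp: sets_uniform_count_measure measurable_def space_uniform_count_measure intro!: AE_I2)
qed

subsection \<open>The perturbed walk\<close>

locale perturbed_walk = prob_space P
  for P :: "'a measure" and X Y :: "nat \<Rightarrow> 'a \<Rightarrow> real \<times> real" +
  assumes iid_X: "iid P {1..} X"
    and iid_Y: "iid P UNIV Y"
    and indep_XY: "indep_var
      (Pi\<^sub>M {1..} (\<lambda>_. borel)) (\<lambda>\<omega>. \<lambda>n\<in>{1..}. X n \<omega>)
      (Pi\<^sub>M UNIV (\<lambda>_. borel)) (\<lambda>\<omega> n. Y n \<omega>)"
    and law_X: "distr P borel (X 1) =
      distr (uniform_count_measure {(1, 0), (-1, 0), (0, 1), (0, -1)}) borel (\<lambda>x. x)"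
    and law_Y: "distr P borel (Y 0) = uniform_measure lborel ({0<..<1} \<times> {0<..<1})"
begin

lemma indep_vars_X: "indep_vars (\<lambda>_. borel) X {1..}"
  using iid_X unfolding iid_def by blast

lemma indep_vars_Y: "indep_vars (\<lambda>_. borel) Y UNIV"
  using iid_Y unfolding iid_def by blast

lemma indep_vars_XY: "indep_vars (\<lambda>_. borel) (case_sum X Y) ({1..} <+> UNIV)"
  using indep_vars_X indep_vars_Y indep_XY by (intro indep_vars_case_sum) (simp_all add: restrict_UNIV)

lemma measurable_X: "k \<ge> 1 \<Longrightarrow> X k \<in> borel_measurable P"
  using indep_vars_X by (auto simp: indep_vars_def)

lemma measurable_Y[measurable]: "Y k \<in> borel_measurable P"
  using indep_vars_Y by (auto simp: indep_vars_def)

lemma distr_X: "k \<ge> 1 \<Longrightarrow> distr P borel (X k) = distr P borel (X 1)"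
  using iid_X unfolding iid_def by (metis atLeast_iff order_refl)

lemma distr_Y: "distr P borel (Y k) = distr P borel (Y 0)"
  using iid_Y unfolding iid_def by blast

abbreviation "steps \<equiv> {(1, 0), (-1, 0), (0, 1), (0, -1)} :: (real \<times> real) set"

lemma prob_X_eq:
  assumes "k \<ge> 1" "e \<in> steps"
  shows "prob {\<omega>\<in>space P. X k \<omega> = e} = 1 / 4"
proof -
  have "prob {\<omega>\<in>space P. X k \<omega> = e} = measure (distr P borel (X k)) {e}"
    using measurable_X[OF assms(1)] by (subst measure_distr) (auto simp: vimage_def Int_def conj_commute)
  also have "\<dots> = 1 / card steps"
    unfolding distr_X[OF assms(1)] law_X using assms(2)
    by (intro measure_distr_uniform_count_measure) simp_all
  also have "\<dots> = 1 / 4" by simp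
  finally show ?thesis .
qed

lemma AE_X_steps: "k \<ge> 1 \<Longrightarrow> AE \<omega> in P. X k \<omega> \<in> steps"
proof -
  assume k: "k \<ge> 1"
  have "AE x in distr P borel (X k). x \<in> steps"
    unfolding distr_X[OF k] law_X by (rule AE_distr_uniform_count_measure) simp
  then show ?thesis by (rule AE_distrD[OF measurable_X[OF k]])
qed

lemma AE_Y_square: "AE \<omega> in P. Y k \<omega> \<in> {0<..<1} \<times> {0<..<1}"
proof -
  have S: "{0<..<1} \<times> {0<..<1} \<in> sets (borel :: (real \<times> real) measure)"
    by (intro borel_open open_Times) auto
  then have "AE x in distr P borel (Y k). x \<in> {0<..<1} \<times> {0<..<1}"
    unfolding distr_Y[of k] law_Y by (intro AE_uniform_measureI) auto
  then show ?thesis by (rule AE_distrD[OF measurable_Y])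
qed

section \<open>Increments of the planar walk\<close>

text \<open>The starting time \<open>i\<close> is a parameter because the last-return decomposition
  restarts the walk at time \<open>i\<close>.\<close>

definition increment :: "nat \<Rightarrow> nat \<Rightarrow> 'a \<Rightarrow> real \<times> real" where
  "increment i n \<omega> = (\<Sum>k=1..n. X (i + k) \<omega>)"

lemma increment_0: "increment 0 n = walk X n"
  by (simp add: increment_def walk_def fun_eq_iff)

lemma measurable_increment[measurable]: "increment i n \<in> borel_measurable P"
  unfolding increment_def[abs_def] using measurable_X by (intro borel_measurable_sum) auto

lemma sets_increment_eq: "{\<omega>\<in>space P. increment i n \<omega> = v} \<in> events"
  using measurable_sets[OF measurable_increment[of i n], of "{v}"]
  by (simp add: vimage_def Int_def conj_commute)

lemma indep_var_increment_X: "indep_var borel (increment i n) borel (X (i + Suc n))"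
proof -
  have "indep_var (Pi\<^sub>M {i<..i+n} (\<lambda>_. borel)) (\<lambda>\<omega>. \<lambda>k\<in>{i<..i+n}. X k \<omega>)
      (Pi\<^sub>M {i + Suc n} (\<lambda>_. borel)) (\<lambda>\<omega>. \<lambda>k\<in>{i + Suc n}. X k \<omega>)"
    by (intro indep_var_restrict[OF indep_vars_X]) auto
  then have "indep_var borel ((\<lambda>f. \<Sum>k=1..n. f (i + k)) \<circ> (\<lambda>\<omega>. \<lambda>k\<in>{i<..i+n}. X k \<omega>))
      borel ((\<lambda>f. f (i + Suc n)) \<circ> (\<lambda>\<omega>. \<lambda>k\<in>{i + Suc n}. X k \<omega>))"
    by (rule indep_var_compose) (auto intro!: borel_measurable_sum measurable_component_singleton)
  also have "(\<lambda>f. \<Sum>k=1..n. f (i + k)) \<circ> (\<lambda>\<omega>. \<lambda>k\<in>{i<..i+n}. X k \<omega>) = increment i n"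
    by (auto simp: increment_def fun_eq_iff intro!: sum.cong)
  finally show ?thesis by (simp add: comp_def)
qed

text \<open>In the rotated coordinates \<open>a + b\<close> and \<open>a - b\<close> the planar walk is a pair of independent
  one-dimensional \<open>\<plusminus>1\<close> walks.\<close>

lemma prob_increment_eq:
  "prob {\<omega>\<in>space P. increment i n \<omega> = (of_int a, of_int b)} = pm_walk_prob n (a + b) * pm_walk_prob n (a - b)"
proof (induction n arbitrary: a b)
  case 0
  show ?case by (auto simp: increment_def zero_prod_def prob_space)
next
  case (Suc n)
  \<comment> \<open>The event is split according to the last step \<open>e\<close>, which is
    independent of the preceding increment.\<close>
  define E where "E = (\<lambda>v e. {\<omega>\<in>space P. increment i n \<omega> = v - e \<and> X (i + Suc n) \<omega> = e})"
  let ?v = "(of_int a, of_int b) :: real \<times> real"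
  have mX[measurable]: "X (i + Suc n) \<in> borel_measurable P" by (rule measurable_X) simp
  have AEX: "AE \<omega> in P. X (i + Suc n) \<omega> \<in> steps" by (rule AE_X_steps) simp
  have E[measurable]: "E v e \<in> sets P" for v e unfolding E_def by measurable
  have "prob (E v e) = prob {\<omega>\<in>space P. increment i n \<omega> = v - e} * (1 / 4)" if "e \<in> steps" for v e
  proof -
    have "E v e = (\<lambda>\<omega>. (increment i n \<omega>, X (i + Suc n) \<omega>)) -` ({v - e} \<times> {e}) \<inter> space P"
      unfolding E_def by auto
    also have "prob \<dots> = prob (increment i n -` {v - e} \<inter> space P) * prob (X (i + Suc n) -` {e} \<inter> space P)"
      by (rule indep_varD[OF indep_var_increment_X]) auto
    also have "prob (X (i + Suc n) -` {e} \<inter> space P) = 1 / 4"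
      using prob_X_eq[of "i + Suc n" e] that by (simp add: vimage_def Int_def conj_commute)
    finally show ?thesis by (simp add: vimage_def Int_def conj_commute)
  qed
  note PE = this
  have "prob {\<omega>\<in>space P. increment i (Suc n) \<omega> = ?v} = prob (\<Union>e\<in>steps. E ?v e)"
  \<comment> \<open>The decomposition holds only almost surely, since the steps may take other
    values on a null set.\<close>
  proof (rule finite_measure_eq_AE)
    show "AE \<omega> in P. \<omega> \<in> {\<omega>\<in>space P. increment i (Suc n) \<omega> = ?v} \<longleftrightarrow> \<omega> \<in> (\<Union>e\<in>steps. E ?v e)"
      using AEX AE_space
    proof eventually_elim
      case (elim \<omega>)
      have "increment i (Suc n) \<omega> = increment i n \<omega> + X (i + Suc n) \<omega>"
        by (simp add: increment_def)
      then have 1: "increment i (Suc n) \<omega> = ?v \<longleftrightarrow> increment i n \<omega> = ?v - X (i + Suc n) \<omega>"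
        by (simp add: eq_diff_eq)
      have 2: "\<omega> \<in> (\<Union>e\<in>T. E ?v e) \<longleftrightarrow> increment i n \<omega> = ?v - X (i + Suc n) \<omega>"
        if "X (i + Suc n) \<omega> \<in> T" for T
        using that elim(2) unfolding E_def by auto
      show ?case unfolding 2[OF elim(1)] using 1 elim(2) by simp
    qed
  qed (auto simp: sets_increment_eq intro!: E)
  also have "\<dots> = (\<Sum>e\<in>steps. prob (E ?v e))"
  proof (rule finite_measure_finite_Union)
    show "disjoint_family_on (E ?v) steps" unfolding disjoint_family_on_def E_def by blast
  qed (auto intro!: E)
  also have "\<dots> = (\<Sum>e\<in>steps. prob {\<omega>\<in>space P. increment i n \<omega> = ?v - e} * (1 / 4))"
    by (rule sum.cong[OF refl], rule PE)
  also have "\<dots> = 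
      (prob {\<omega>\<in>space P. increment i n \<omega> = (of_int (a - 1), of_int b)}
      + prob {\<omega>\<in>space P. increment i n \<omega> = (of_int (a + 1), of_int b)}
      + prob {\<omega>\<in>space P. increment i n \<omega> = (of_int a, of_int (b - 1))}
      + prob {\<omega>\<in>space P. increment i n \<omega> = (of_int a, of_int (b + 1))}) / 4"
    by simp
  \<comment> \<open>Changing \<open>a\<close> by 1 moves a + b and a - b in the same direction,
    changing \<open>b\<close> moves them in opposite directions. The four products thus form the
    product of two sums of two terms.\<close>
  also have "\<dots> = pm_walk_prob (Suc n) (a + b) * pm_walk_prob (Suc n) (a - b)"
    unfolding Suc.IH by (simp add: algebra_simps)
  finally show ?case .
qed

lemma prob_increment_eq_0: "prob {\<omega>\<in>space P. increment i n \<omega> = 0} = (pm_walk_prob n 0)\<^sup>2"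
  using prob_increment_eq[of i n 0 0] by (simp add: power2_eq_square zero_prod_def)

lemma AE_walk_Ints: "AE \<omega> in P. \<forall>n. fst (walk X n \<omega>) \<in> \<int> \<and> snd (walk X n \<omega>) \<in> \<int>"
proof -
  have "AE \<omega> in P. \<forall>k\<in>{1..}. X k \<omega> \<in> steps"
    by (subst AE_ball_countable) (auto intro: AE_X_steps simp del: insert_iff)
  then show ?thesis
  proof eventually_elim
    case (elim \<omega>)
    show ?case
    proof
      fix n
      have "fst (X k \<omega>) \<in> \<int> \<and> snd (X k \<omega>) \<in> \<int>" if "k \<in> {1..n}" for k
        using bspec[OF elim, of k] that by auto
      then show "fst (walk X n \<omega>) \<in> \<int> \<and> snd (walk X n \<omega>) \<in> \<int>"
        unfolding walk_def fst_sum snd_sum by (intro conjI Ints_sum) auto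
    qed
  qed
qed

section \<open>Marked times and the last-mark decomposition\<close>

text \<open>A time is marked if the walk is back at its position at time \<open>i\<close> and the
  perturbation lies in \<open>B\<close>. Later \<open>B\<close> is the ball around a frozen value of
  \<open>Y 0\<close>, which makes marks into returns.\<close>

definition no_mark :: "(real \<times> real) set \<Rightarrow> nat \<Rightarrow> nat \<Rightarrow> 'a set" where
  "no_mark B i n = {\<omega>\<in>space P. \<forall>m\<in>{1..n}. \<not> (increment i m \<omega> = 0 \<and> Y (i + m) \<omega> \<in> B)}"

lemma sets_no_mark: "B \<in> sets borel \<Longrightarrow> no_mark B i n \<in> events"
proof -
  assume [measurable]: "B \<in> sets borel"
  have "{\<omega>\<in>space P. \<not> (increment i m \<omega> = 0 \<and> Y (i + m) \<omega> \<in> B)} \<in> events" for m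
    using sets_increment_eq[of i m 0] by (intro sets.sets_Collect_neg sets.sets_Collect_conj) auto
  then show ?thesis unfolding no_mark_def by (intro sets.sets_Collect_finite_All) auto
qed

text \<open>The event is the same function \<open>F\<close> of finitely many steps and perturbations
  for every \<open>i\<close>, and by independence and identical distribution their joint law is one
  product measure.\<close>

lemma prob_no_mark_shift:
  assumes B: "B \<in> sets borel"
  shows "prob (no_mark B i n) = prob (no_mark B 0 n)"
\<comment> \<open>For \<open>n = 0\<close> the index set \<open>J\<close> is empty, and the
  characterisation of independence by product laws is applied to a nonempty one.\<close>
proof (cases "n = 0")
  case True
  then show ?thesis by (simp add: no_mark_def)
next
  case False
  define J where "J = {1..n} <+> {1..n}"
  define Z where "Z = case_sum X Y"
  define sh where "sh = (\<lambda>i::nat. map_sum ((+) i) ((+) i))"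
  define F where "F = {f \<in> space (Pi\<^sub>M J (\<lambda>_. borel)). \<forall>m\<in>{1..n}. \<not> ((\<Sum>k=1..m. f (Inl k)) = (0::real\<times>real) \<and> f (Inr m) \<in> B)}"
  have F: "F \<in> sets (Pi\<^sub>M J (\<lambda>_. borel))"
    unfolding F_def
  proof (intro sets.sets_Collect_finite_All sets.sets_Collect_neg sets.sets_Collect_conj)
    fix m assume m: "m \<in> {1..n}"
    have "(\<lambda>f. \<Sum>k=1..m. f (Inl k)) \<in> borel_measurable (Pi\<^sub>M J (\<lambda>_. borel :: (real \<times> real) measure))"
      using m by (intro borel_measurable_sum measurable_component_singleton) (auto simp: J_def)
    from measurable_sets[OF this, of "{0}"]
    show "{f \<in> space (Pi\<^sub>M J (\<lambda>_. borel)). (\<Sum>k=1..m. f (Inl k)) = (0::real \<times> real)} \<in> sets (Pi\<^sub>M J (\<lambda>_. borel))"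
      by (simp add: vimage_def Int_def conj_commute)
    have "(\<lambda>f. f (Inr m)) \<in> borel_measurable (Pi\<^sub>M J (\<lambda>_. borel :: (real \<times> real) measure))"
      using m by (intro measurable_component_singleton) (auto simp: J_def)
    from measurable_sets[OF this B]
    show "{f \<in> space (Pi\<^sub>M J (\<lambda>_. borel)). f (Inr m) \<in> B} \<in> sets (Pi\<^sub>M J (\<lambda>_. borel))"
      by (simp add: vimage_def Int_def conj_commute)
  qed simp
  have rv: "Z j \<in> borel_measurable P" if "j \<in> {1..} <+> UNIV" for j
    using that measurable_X by (auto simp: Z_def)
  have shJ: "sh i j \<in> {1..} <+> UNIV" if "j \<in> J" for i j
    using that by (auto simp: sh_def J_def)
  have law: "distr P (Pi\<^sub>M J (\<lambda>_. borel)) (\<lambda>\<omega>. \<lambda>j\<in>J. Z (sh i j) \<omega>) = Pi\<^sub>M J (\<lambda>j. distr P borel (Z j))" for i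
  proof -
    have "indep_vars (\<lambda>_. borel) (\<lambda>j. Z (sh i j)) J"
      unfolding Z_def using shJ
      by (intro indep_vars_reindex_inj[OF indep_vars_XY]) (auto simp: inj_on_def sh_def J_def)
    then have "distr P (Pi\<^sub>M J (\<lambda>_. borel)) (\<lambda>\<omega>. \<lambda>j\<in>J. Z (sh i j) \<omega>) = Pi\<^sub>M J (\<lambda>j. distr P borel (Z (sh i j)))"
      using False rv shJ by (subst indep_vars_iff_distr_eq_PiM'[symmetric]) (auto simp: J_def)
    also have "\<dots> = Pi\<^sub>M J (\<lambda>j. distr P borel (Z j))"
    proof (intro PiM_cong refl)
      fix j assume j: "j \<in> J"
      show "distr P borel (Z (sh i j)) = distr P borel (Z j)"
      proof (cases j)
        case (Inl k)
        with j have "k \<ge> 1" "i + k \<ge> 1" by (auto simp: J_def)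
        then show ?thesis using Inl distr_X[of k] distr_X[of "i + k"] by (simp add: Z_def sh_def)
      next
        case (Inr k)
        then show ?thesis using distr_Y[of k] distr_Y[of "i + k"] by (simp add: Z_def sh_def)
      qed
    qed
    finally show ?thesis .
  qed
  have "prob (no_mark B i n) = measure (Pi\<^sub>M J (\<lambda>j. distr P borel (Z j))) F" for i
  proof -
    have m: "(\<lambda>\<omega>. \<lambda>j\<in>J. Z (sh i j) \<omega>) \<in> measurable P (Pi\<^sub>M J (\<lambda>_. borel))"
      using rv shJ by (intro measurable_restrict) auto
    have "no_mark B i n = (\<lambda>\<omega>. \<lambda>j\<in>J. Z (sh i j) \<omega>) -` F \<inter> space P"
    proof -
      have "(\<Sum>k=1..m. (\<lambda>j\<in>J. Z (sh i j) \<omega>) (Inl k)) = increment i m \<omega>"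
        "(\<lambda>j\<in>J. Z (sh i j) \<omega>) (Inr m) = Y (i + m) \<omega>" if "m \<in> {1..n}" for m \<omega>
        using that by (auto simp: J_def Z_def sh_def increment_def intro!: sum.cong)
      then have "(\<lambda>j\<in>J. Z (sh i j) \<omega>) \<in> F \<longleftrightarrow> \<omega> \<in> no_mark B i n" if "\<omega> \<in> space P" for \<omega>
        unfolding F_def no_mark_def using that measurable_space[OF m that]
        by (simp del: restrict_apply)
      then show ?thesis by (auto simp: no_mark_def)
    qed
    then show ?thesis
      unfolding law[of i, symmetric] using m F by (simp add: measure_distr)
  qed
  then show ?thesis by simp
qed

lemma prob_increment_eq_0_and_Y:
  assumes B: "B \<in> sets borel"
  shows "prob {\<omega>\<in>space P. increment 0 n \<omega> = 0 \<and> Y n \<omega> \<in> B} = (pm_walk_prob n 0)\<^sup>2 * measure (distr P borel (Y 0)) B"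
proof -
  have "indep_var borel ((\<lambda>f. \<Sum>k=1..n. f (0 + k)) \<circ> (\<lambda>\<omega>. \<lambda>n\<in>{1..}. X n \<omega>)) borel ((\<lambda>f. f n) \<circ> (\<lambda>\<omega> n. Y n \<omega>))"
    by (rule indep_var_compose[OF indep_XY]) (auto intro!: borel_measurable_sum measurable_component_singleton)
  also have "(\<lambda>f. \<Sum>k=1..n. f (0 + k)) \<circ> (\<lambda>\<omega>. \<lambda>n\<in>{1..}. X n \<omega>) = increment 0 n"
    by (auto simp: increment_def fun_eq_iff)
  also have "(\<lambda>f. f n) \<circ> (\<lambda>\<omega> n. Y n \<omega>) = Y n" by auto
  finally have ind: "indep_var borel (increment 0 n) borel (Y n)" .
  have "prob ((\<lambda>\<omega>. (increment 0 n \<omega>, Y n \<omega>)) -` ({0} \<times> B) \<inter> space P)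
      = prob (increment 0 n -` {0} \<inter> space P) * prob (Y n -` B \<inter> space P)"
    by (rule indep_varD[OF ind]) (use B in auto)
  moreover have "prob (increment 0 n -` {0} \<inter> space P) = (pm_walk_prob n 0)\<^sup>2"
    using prob_increment_eq_0[of 0 n] by (simp add: vimage_def Int_def conj_commute)
  moreover have "prob (Y n -` B \<inter> space P) = measure (distr P borel (Y 0)) B"
    using B by (subst distr_Y[of n, symmetric], subst measure_distr) auto
  moreover have "(\<lambda>\<omega>. (increment 0 n \<omega>, Y n \<omega>)) -` ({0} \<times> B) \<inter> space P = {\<omega>\<in>space P. increment 0 n \<omega> = 0 \<and> Y n \<omega> \<in> B}"
    by auto
  ultimately show ?thesis by simp
qed

text \<open>A mark at \<open>i\<close> depends on the steps up to \<open>i\<close> and on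
  \<open>Y i\<close>, the absence of later marks only on later steps and perturbations. These blocks
  are disjoint, and the second factor is stationary.\<close>

lemma prob_mark_Int_no_mark:
  assumes B: "B \<in> sets borel"
  shows "prob ({\<omega>\<in>space P. increment 0 i \<omega> = 0 \<and> Y i \<omega> \<in> B} \<inter> no_mark B i n)
    = (pm_walk_prob i 0)\<^sup>2 * measure (distr P borel (Y 0)) B * prob (no_mark B 0 n)"
proof -
  define J where "J = {1..i} <+> {i}"
  define K where "K = {i<..i+n} <+> {i<..i+n}"
  define Z where "Z = case_sum X Y"
  let ?MJ = "Pi\<^sub>M J (\<lambda>_. borel :: (real \<times> real) measure)"
  let ?MK = "Pi\<^sub>M K (\<lambda>_. borel :: (real \<times> real) measure)"
  have ind: "indep_var ?MJ (\<lambda>\<omega>. \<lambda>j\<in>J. Z j \<omega>) ?MK (\<lambda>\<omega>. \<lambda>j\<in>K. Z j \<omega>)"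
    unfolding Z_def by (intro indep_var_restrict[OF indep_vars_XY]) (auto simp: J_def K_def)
  define F where "F = {f \<in> space ?MJ. (\<Sum>k=1..i. f (Inl k)) = (0::real\<times>real) \<and> f (Inr i) \<in> B}"
  define G where "G = {f \<in> space ?MK. \<forall>m\<in>{1..n}. \<not> ((\<Sum>k=1..m. f (Inl (i + k))) = (0::real\<times>real) \<and> f (Inr (i + m)) \<in> B)}"
  have F: "F \<in> sets ?MJ"
    unfolding F_def
  proof (intro sets.sets_Collect_conj)
    have "(\<lambda>f. \<Sum>k=1..i. f (Inl k)) \<in> borel_measurable ?MJ"
      by (intro borel_measurable_sum measurable_component_singleton) (auto simp: J_def)
    from measurable_sets[OF this, of "{0}"]
    show "{f \<in> space ?MJ. (\<Sum>k=1..i. f (Inl k)) = 0} \<in> sets ?MJ"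
      by (simp add: vimage_def Int_def conj_commute)
    have "(\<lambda>f. f (Inr i)) \<in> borel_measurable ?MJ"
      by (intro measurable_component_singleton) (auto simp: J_def)
    from measurable_sets[OF this B]
    show "{f \<in> space ?MJ. f (Inr i) \<in> B} \<in> sets ?MJ"
      by (simp add: vimage_def Int_def conj_commute)
  qed
  have G: "G \<in> sets ?MK"
    unfolding G_def
  proof (intro sets.sets_Collect_finite_All sets.sets_Collect_neg sets.sets_Collect_conj)
    fix m assume m: "m \<in> {1..n}"
    have "(\<lambda>f. \<Sum>k=1..m. f (Inl (i + k))) \<in> borel_measurable ?MK"
      using m by (intro borel_measurable_sum measurable_component_singleton) (auto simp: K_def)
    from measurable_sets[OF this, of "{0}"]
    show "{f \<in> space ?MK. (\<Sum>k=1..m. f (Inl (i + k))) = 0} \<in> sets ?MK"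
      by (simp add: vimage_def Int_def conj_commute)
    have "(\<lambda>f. f (Inr (i + m))) \<in> borel_measurable ?MK"
      using m by (intro measurable_component_singleton) (auto simp: K_def)
    from measurable_sets[OF this B]
    show "{f \<in> space ?MK. f (Inr (i + m)) \<in> B} \<in> sets ?MK"
      by (simp add: vimage_def Int_def conj_commute)
  qed simp
  have mJ: "(\<lambda>\<omega>. \<lambda>j\<in>J. Z j \<omega>) \<in> measurable P ?MJ" and mK: "(\<lambda>\<omega>. \<lambda>j\<in>K. Z j \<omega>) \<in> measurable P ?MK"
    using indep_var_rv1[OF ind] indep_var_rv2[OF ind] by auto
  have eF: "(\<lambda>\<omega>. \<lambda>j\<in>J. Z j \<omega>) -` F \<inter> space P = {\<omega>\<in>space P. increment 0 i \<omega> = 0 \<and> Y i \<omega> \<in> B}"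
  proof -
    have "(\<Sum>k=1..i. (\<lambda>j\<in>J. Z j \<omega>) (Inl k)) = increment 0 i \<omega>" "(\<lambda>j\<in>J. Z j \<omega>) (Inr i) = Y i \<omega>" for \<omega>
      by (auto simp: J_def Z_def increment_def intro!: sum.cong)
    then have "(\<lambda>j\<in>J. Z j \<omega>) \<in> F \<longleftrightarrow> increment 0 i \<omega> = 0 \<and> Y i \<omega> \<in> B" if "\<omega> \<in> space P" for \<omega>
      unfolding F_def using measurable_space[OF mJ that] by (simp del: restrict_apply)
    then show ?thesis by blast
  qed
  have eG: "(\<lambda>\<omega>. \<lambda>j\<in>K. Z j \<omega>) -` G \<inter> space P = no_mark B i n"
  proof -
    have "(\<Sum>k=1..m. (\<lambda>j\<in>K. Z j \<omega>) (Inl (i + k))) = increment i m \<omega>"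
      "(\<lambda>j\<in>K. Z j \<omega>) (Inr (i + m)) = Y (i + m) \<omega>" if "m \<in> {1..n}" for m \<omega>
      using that by (auto simp: K_def Z_def increment_def intro!: sum.cong)
    then have "(\<lambda>j\<in>K. Z j \<omega>) \<in> G \<longleftrightarrow> \<omega> \<in> no_mark B i n" if "\<omega> \<in> space P" for \<omega>
      unfolding G_def no_mark_def using that measurable_space[OF mK that]
      by (simp del: restrict_apply)
    then show ?thesis by (auto simp: no_mark_def)
  qed
  have "{\<omega>\<in>space P. increment 0 i \<omega> = 0 \<and> Y i \<omega> \<in> B} \<inter> no_mark B i n
    = (\<lambda>\<omega>. (\<lambda>j\<in>J. Z j \<omega>, \<lambda>j\<in>K. Z j \<omega>)) -` (F \<times> G) \<inter> space P"
    unfolding eF[symmetric] eG[symmetric] by blast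
  also have "prob \<dots> = prob {\<omega>\<in>space P. increment 0 i \<omega> = 0 \<and> Y i \<omega> \<in> B} * prob (no_mark B i n)"
    unfolding eF[symmetric] eG[symmetric] by (rule indep_varD[OF ind F G])
  finally show ?thesis
    by (simp add: prob_increment_eq_0_and_Y[OF B] prob_no_mark_shift[OF B, of i])
qed

text \<open>The events that \<open>i\<close> is the last marked time up to \<open>n\<close> (time \<open>0\<close> counting as marked) are disjoint;
  by independence and stationarity each has probability at least \<open>P(i is marked) * P(no mark up to n)\<close>.\<close>

lemma prob_no_mark_le:
  assumes B: "B \<in> sets borel"
  shows "prob (no_mark B 0 n) * (1 + measure (distr P borel (Y 0)) B * (\<Sum>m=1..n. (pm_walk_prob m 0)\<^sup>2)) \<le> 1"
proof -
  let ?p = "measure (distr P borel (Y 0)) B"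
  let ?M = "\<lambda>i. {\<omega>\<in>space P. increment 0 i \<omega> = 0 \<and> Y i \<omega> \<in> B}"
  define A where "A = (\<lambda>i. if i = 0 then no_mark B 0 n else ?M i \<inter> no_mark B i (n - i))"
  have M: "?M i \<in> events" for i
    using sets_increment_eq[of 0 i 0] B by (intro sets.sets_Collect_conj) auto
  have A: "A i \<in> events" for i
    unfolding A_def using M sets_no_mark[OF B] by (auto intro: sets.Int)
  have no: "A i \<inter> A j = {}" if "i < j" "j \<le> n" for i j
  proof -
    have False if "\<omega> \<in> A i" "\<omega> \<in> A j" for \<omega>
    proof -
      have j: "increment 0 j \<omega> = 0" "Y j \<omega> \<in> B" using that(2) \<open>i < j\<close> by (auto simp: A_def)
      have i: "\<omega> \<in> no_mark B i (n - i)" "increment 0 i \<omega> = 0"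
        using that(1) by (auto simp: A_def increment_def split: if_splits)
      \<comment> \<open>If \<open>i\<close> is the last mark and \<open>j > i\<close> is also
        marked, the walk restarted at \<open>i\<close> is at 0 after \<open>j - i\<close> steps, so
        \<open>j - i\<close> is a mark excluded by \<open>no_mark\<close>.\<close>
      have "increment 0 j \<omega> = increment 0 i \<omega> + increment i (j - i) \<omega>"
      proof -
        have "increment 0 (i + d) \<omega> = increment 0 i \<omega> + increment i d \<omega>" for d
          by (induction d) (auto simp: increment_def)
        from this[of "j - i"] show ?thesis using \<open>i < j\<close> by simp
      qed
      then have "increment i (j - i) \<omega> = 0" using i j by simp
      moreover have "j - i \<in> {1..n - i}" "i + (j - i) = j" using \<open>i < j\<close> \<open>j \<le> n\<close> by auto
      ultimately show False using i(1) j(2) unfolding no_mark_def by fastforce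
    qed
    then show ?thesis by blast
  qed
  have "disjoint_family_on A {0..n}"
    unfolding disjoint_family_on_def using no by (metis Int_commute atLeastAtMost_iff linorder_neqE_nat)
  then have "(\<Sum>i\<in>{0..n}. prob (A i)) = prob (\<Union>i\<in>{0..n}. A i)"
    using A by (intro finite_measure_finite_Union[symmetric]) auto
  then have "(\<Sum>i\<in>{0..n}. prob (A i)) \<le> 1" by simp
  moreover have "prob (A i) \<ge> (pm_walk_prob i 0)\<^sup>2 * ?p * prob (no_mark B 0 n)" if "i \<in> {1..n}" for i
  proof -
    have "prob (A i) = (pm_walk_prob i 0)\<^sup>2 * ?p * prob (no_mark B 0 (n - i))"
      using that by (simp add: A_def prob_mark_Int_no_mark[OF B])
    \<comment> \<open>Lengthening the horizon from \<open>n - i\<close> to \<open>n\<close> shrinks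
      the event, which makes the factor independent of \<open>i\<close>.\<close>
    moreover have "prob (no_mark B 0 n) \<le> prob (no_mark B 0 (n - i))"
      by (rule finite_measure_mono[OF _ sets_no_mark[OF B]]) (auto simp: no_mark_def)
    ultimately show ?thesis by (simp add: mult_left_mono)
  qed
  then have "(\<Sum>i=1..n. (pm_walk_prob i 0)\<^sup>2 * ?p * prob (no_mark B 0 n)) \<le> (\<Sum>i=1..n. prob (A i))"
    by (rule sum_mono)
  moreover have "(\<Sum>i\<in>{0..n}. prob (A i)) = prob (no_mark B 0 n) + (\<Sum>i=1..n. prob (A i))"
    by (subst sum.atLeast_Suc_atMost) (auto simp: A_def)
  ultimately show ?thesis
    by (simp add: sum_distrib_left sum_distrib_right algebra_simps)
qed

section \<open>Conditioning on the initial perturbation\<close>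

text \<open>This is Fubini's theorem: \<open>J\<close> omits \<open>Inr 0\<close>, so
  \<open>Y 0\<close> is independent of \<open>R\<close>, and a bound valid for each fixed
  \<open>y\<close> survives integration over the law of \<open>Y 0\<close>. Only \<open>y\<close> in
  the open square matter, since \<open>Y 0\<close> lies there almost surely.\<close>

lemma prob_freeze_Y0:
  fixes J :: "(nat + nat) set"
  defines "MJ \<equiv> Pi\<^sub>M J (\<lambda>_. borel :: (real \<times> real) measure)"
    and "R \<equiv> \<lambda>\<omega>. \<lambda>j\<in>J. case_sum X Y j \<omega>"
  assumes J: "J \<subseteq> {1..} <+> {1..}" and G: "G \<in> sets (borel \<Otimes>\<^sub>M MJ)"
    and c: "\<And>y. y \<in> {0<..<1} \<times> {0<..<1} \<Longrightarrow> prob {\<omega>\<in>space P. (y, R \<omega>) \<in> G} \<le> c"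
  shows "prob {\<omega>\<in>space P. (Y 0 \<omega>, R \<omega>) \<in> G} \<le> c"
proof -
  let ?S = "{0<..<1} \<times> {0<..<1} :: (real \<times> real) set"
  \<comment> \<open>Any point of the square would do; it shows that \<open>c\<close> is
    nonnegative.\<close>
  have "(1/2, 1/2) \<in> ?S" by simp
  from order_trans[OF measure_nonneg c[OF this]] have c0: "c \<ge> 0" .
  \<comment> \<open>\<open>Y 0\<close> is treated as a family with one member, so that independence
    comes from disjoint blocks; \<open>G'\<close> is \<open>G\<close> pulled back along evaluation
    at \<open>Inr 0\<close>.\<close>
  define M0 where "M0 = Pi\<^sub>M {Inr 0 :: nat + nat} (\<lambda>_. borel :: (real \<times> real) measure)"
  define R0 where "R0 = (\<lambda>\<omega>. \<lambda>j\<in>{Inr 0}. case_sum X Y j \<omega>)"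
  have R0: "R0 \<omega> (Inr 0) = Y 0 \<omega>" for \<omega> by (simp add: R0_def)
  have ind: "indep_var M0 R0 MJ R"
    unfolding M0_def R0_def MJ_def R_def using J by (intro indep_var_restrict[OF indep_vars_XY]) auto
  have mR0: "R0 \<in> measurable P M0" and mR: "R \<in> measurable P MJ"
    using indep_var_rv1[OF ind] indep_var_rv2[OF ind] by auto
  interpret D0: prob_space "distr P M0 R0" by (rule prob_space_distr[OF mR0])
  interpret DR: prob_space "distr P MJ R" by (rule prob_space_distr[OF mR])
  have ev0: "(\<lambda>f. f (Inr 0)) \<in> measurable M0 borel"
    unfolding M0_def by (rule measurable_component_singleton) simp
  have sq: "AE f in distr P M0 R0. f (Inr 0) \<in> ?S"
  proof (subst AE_distr_iff[OF mR0])
    have "?S \<in> sets borel" by (intro borel_open open_Times) auto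
    from measurable_sets[OF ev0 this] show "{f \<in> space M0. f (Inr 0) \<in> ?S} \<in> sets M0"
      by (simp only: vimage_def Int_def mem_Collect_eq conj_commute)
    show "AE \<omega> in P. R0 \<omega> (Inr 0) \<in> ?S" unfolding R0 by (rule AE_Y_square)
  qed
  define G' where "G' = (\<lambda>p. (fst p (Inr 0), snd p)) -` G \<inter> space (M0 \<Otimes>\<^sub>M MJ)"
  have G': "G' \<in> sets (M0 \<Otimes>\<^sub>M MJ)"
    unfolding G'_def
    by (rule measurable_sets[OF measurable_Pair[OF measurable_compose[OF measurable_fst ev0] measurable_snd] G])
  have slice: "Pair f -` G' = Pair (f (Inr 0)) -` G" if "f \<in> space M0" for f
    using sets.sets_into_space[OF G] that by (auto simp: G'_def space_pair_measure)
  have pr: "(\<lambda>\<omega>. (R0 \<omega>, R \<omega>)) \<in> measurable P (M0 \<Otimes>\<^sub>M MJ)"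
    by (rule measurable_Pair[OF mR0 mR])
  have "{\<omega>\<in>space P. (Y 0 \<omega>, R \<omega>) \<in> G} = (\<lambda>\<omega>. (R0 \<omega>, R \<omega>)) -` G' \<inter> space P"
    using measurable_space[OF pr] by (auto simp: G'_def R0)
  then have "ennreal (prob {\<omega>\<in>space P. (Y 0 \<omega>, R \<omega>) \<in> G}) = emeasure (distr P (M0 \<Otimes>\<^sub>M MJ) (\<lambda>\<omega>. (R0 \<omega>, R \<omega>))) G'"
    by (simp add: emeasure_distr[OF pr G'] emeasure_eq_measure)
  also have "\<dots> = emeasure (distr P M0 R0 \<Otimes>\<^sub>M distr P MJ R) G'"
    using ind unfolding indep_var_distribution_eq by simp
  also have "\<dots> = (\<integral>\<^sup>+f. emeasure (distr P MJ R) (Pair f -` G') \<partial>distr P M0 R0)"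
  proof (rule DR.emeasure_pair_measure_alt)
    have "sets (distr P M0 R0 \<Otimes>\<^sub>M distr P MJ R) = sets (M0 \<Otimes>\<^sub>M MJ)"
      by (rule sets_pair_measure_cong) simp_all
    then show "G' \<in> sets (distr P M0 R0 \<Otimes>\<^sub>M distr P MJ R)" using G' by simp
  qed
  also have "\<dots> \<le> (\<integral>\<^sup>+f. ennreal c \<partial>distr P M0 R0)"
  proof (rule nn_integral_mono_AE)
    show "AE f in distr P M0 R0. emeasure (distr P MJ R) (Pair f -` G') \<le> ennreal c"
      using sq AE_space
    proof eventually_elim
      case (elim f)
      have "emeasure (distr P MJ R) (Pair f -` G') = emeasure P (R -` (Pair (f (Inr 0)) -` G) \<inter> space P)"
        using elim(2) slice by (simp add: emeasure_distr[OF mR sets_Pair1[OF G]])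
      also have "\<dots> = ennreal (prob {\<omega>\<in>space P. (f (Inr 0), R \<omega>) \<in> G})"
        by (simp add: emeasure_eq_measure vimage_def Int_def conj_commute)
      finally show ?case using c[OF elim(1)] by (simp add: ennreal_leI)
    qed
  qed
  also have "\<dots> = ennreal c"
    using D0.emeasure_space_1 by simp
  finally show ?thesis using c0 by simp
qed

text \<open>A return for which the walk itself is exactly at the origin. Unlike general returns,
  these factor into a walk event and a perturbation event once \<open>Y 0\<close> is frozen.\<close>

definition near_return :: "real \<Rightarrow> nat \<Rightarrow> 'a set" where
  "near_return \<epsilon> m = {\<omega>\<in>space P. increment 0 m \<omega> = 0 \<and> norm (Y m \<omega> - Y 0 \<omega>) < \<epsilon>}"

lemma sets_near_return: "near_return \<epsilon> m \<in> events"
  unfolding near_return_def using sets_increment_eq[of 0 m 0] by (intro sets.sets_Collect_conj) auto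

lemma sets_near_return_law:
  fixes \<epsilon> :: real
  assumes m: "{1..m} <+> {m} \<subseteq> J"
  defines "MJ \<equiv> Pi\<^sub>M J (\<lambda>_. borel :: (real \<times> real) measure)"
  shows "{p \<in> space (borel \<Otimes>\<^sub>M MJ). (\<Sum>k=1..m. snd p (Inl k)) = 0 \<and> norm (snd p (Inr m) - fst p) < \<epsilon>}
    \<in> sets (borel \<Otimes>\<^sub>M MJ)"
proof (rule sets.sets_Collect_conj)
  have comp: "(\<lambda>p. snd p j) \<in> borel_measurable (borel \<Otimes>\<^sub>M MJ)" if "j \<in> J" for j
    unfolding MJ_def using that
    by (rule measurable_compose[OF measurable_snd measurable_component_singleton])
  have "(\<lambda>p. \<Sum>k=1..m. snd p (Inl k)) \<in> borel_measurable (borel \<Otimes>\<^sub>M MJ)"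
    using m by (intro borel_measurable_sum comp) auto
  from measurable_sets[OF this, of "{0}"]
  show "{p \<in> space (borel \<Otimes>\<^sub>M MJ). (\<Sum>k=1..m. snd p (Inl k)) = 0} \<in> sets (borel \<Otimes>\<^sub>M MJ)"
    by (simp add: vimage_def Int_def conj_commute)
  have "(\<lambda>p. snd p (Inr m) - fst p) \<in> borel_measurable (borel \<Otimes>\<^sub>M MJ)"
    using m by (intro borel_measurable_diff comp measurable_fst) auto
  then have "(\<lambda>p. norm (snd p (Inr m) - fst p)) \<in> borel_measurable (borel \<Otimes>\<^sub>M MJ)"
    by (rule measurable_compose[OF _ borel_measurable_norm])
  from measurable_sets[OF this, of "{..<\<epsilon>}"]
  show "{p \<in> space (borel \<Otimes>\<^sub>M MJ). norm (snd p (Inr m) - fst p) < \<epsilon>} \<in> sets (borel \<Otimes>\<^sub>M MJ)"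
    by (simp add: vimage_def Int_def conj_commute)
qed

lemma sum_restrict_XY:
  assumes "{1..m} <+> {m} \<subseteq> J"
  shows "(\<Sum>k=1..m. (\<lambda>j\<in>J. case_sum X Y j \<omega>) (Inl k)) = increment 0 m \<omega>"
    "(\<lambda>j\<in>J. case_sum X Y j \<omega>) (Inr m) = Y m \<omega>"
  using assms by (auto simp: increment_def intro!: sum.cong)

text \<open>With \<open>Y 0\<close> frozen at \<open>y\<close>, the event is a mark at
  \<open>m\<close> for \<open>ball y \<epsilon>\<close>, whose probability is a product.\<close>

lemma prob_near_return_le:
  assumes \<epsilon>: "0 < \<epsilon>" "\<epsilon> \<le> 1" and m: "m \<ge> 1"
  shows "prob (near_return \<epsilon> m) \<le> (pm_walk_prob m 0)\<^sup>2 * (4 * \<epsilon>\<^sup>2)"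
proof -
  define J where "J = {1..m} <+> {m}"
  define MJ where "MJ = Pi\<^sub>M J (\<lambda>_. borel :: (real \<times> real) measure)"
  define G where "G = {p \<in> space (borel \<Otimes>\<^sub>M MJ). (\<Sum>k=1..m. snd p (Inl k)) = 0 \<and> norm (snd p (Inr m) - fst p) < \<epsilon>}"
  define R where "R \<omega> = (\<lambda>j\<in>J. case_sum X Y j \<omega>)" for \<omega>
  have G: "G \<in> sets (borel \<Otimes>\<^sub>M MJ)"
    unfolding G_def MJ_def by (rule sets_near_return_law) (simp add: J_def)
  have R: "(\<Sum>k=1..m. R \<omega> (Inl k)) = increment 0 m \<omega>" "R \<omega> (Inr m) = Y m \<omega>" for \<omega>
    unfolding R_def by (rule sum_restrict_XY, simp add: J_def)+
  have sp: "R \<omega> \<in> space MJ" for \<omega> by (simp add: R_def MJ_def space_PiM)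
  have iff: "(y, R \<omega>) \<in> G \<longleftrightarrow> increment 0 m \<omega> = 0 \<and> norm (Y m \<omega> - y) < \<epsilon>" for y \<omega>
    unfolding G_def using sp by (simp add: R space_pair_measure del: One_nat_def)
  have "prob {\<omega>\<in>space P. (Y 0 \<omega>, R \<omega>) \<in> G} \<le> (pm_walk_prob m 0)\<^sup>2 * (4 * \<epsilon>\<^sup>2)"
    unfolding R_def
  proof (rule prob_freeze_Y0, fold R_def)
    show "J \<subseteq> {1..} <+> {1..}" using m by (auto simp: J_def)
    show "G \<in> sets (borel \<Otimes>\<^sub>M Pi\<^sub>M J (\<lambda>_. borel))" using G by (simp add: MJ_def)
    fix y :: "real \<times> real" assume y: "y \<in> {0<..<1} \<times> {0<..<1}"
    have "{\<omega>\<in>space P. (y, R \<omega>) \<in> G} = {\<omega>\<in>space P. increment 0 m \<omega> = 0 \<and> Y m \<omega> \<in> ball y \<epsilon>}"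
      by (simp add: iff dist_norm norm_minus_commute)
    then have "prob {\<omega>\<in>space P. (y, R \<omega>) \<in> G} = (pm_walk_prob m 0)\<^sup>2 * measure (distr P borel (Y 0)) (ball y \<epsilon>)"
      by (simp only: prob_increment_eq_0_and_Y[OF borel_open[OF open_ball]])
    also have "\<dots> \<le> (pm_walk_prob m 0)\<^sup>2 * (4 * \<epsilon>\<^sup>2)"
      unfolding law_Y using measure_uniform_unit_square_ball(2)[OF y \<epsilon>] by (intro mult_left_mono) auto
    finally show "prob {\<omega>\<in>space P. (y, R \<omega>) \<in> G} \<le> (pm_walk_prob m 0)\<^sup>2 * (4 * \<epsilon>\<^sup>2)" .
  qed
  then show ?thesis by (simp add: iff near_return_def)
qed

text \<open>With \<open>Y 0\<close> frozen at \<open>y\<close>, the event is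
  \<open>no_mark (ball y \<epsilon>) 0 n\<close>. The estimate \<open>prob_no_mark_le\<close>
  applies, and the measure of the ball may be lowered to \<epsilon>^2/4 uniformly in
  \<open>y\<close>.\<close>

lemma prob_no_near_return_le:
  assumes \<epsilon>: "0 < \<epsilon>" "\<epsilon> \<le> 1"
  shows "prob {\<omega>\<in>space P. \<forall>m\<in>{1..n}. \<omega> \<notin> near_return \<epsilon> m}
    \<le> 1 / (1 + \<epsilon>\<^sup>2 / 4 * (\<Sum>m=1..n. (pm_walk_prob m 0)\<^sup>2))"
proof -
  let ?g = "\<Sum>m=1..n. (pm_walk_prob m 0)\<^sup>2"
  define J where "J = {1..n} <+> {1..n}"
  define MJ where "MJ = Pi\<^sub>M J (\<lambda>_. borel :: (real \<times> real) measure)"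
  define G where "G = {p \<in> space (borel \<Otimes>\<^sub>M MJ). \<forall>m\<in>{1..n}.
    \<not> ((\<Sum>k=1..m. snd p (Inl k)) = 0 \<and> norm (snd p (Inr m) - fst p) < \<epsilon>)}"
  define R where "R \<omega> = (\<lambda>j\<in>J. case_sum X Y j \<omega>)" for \<omega>
  have G: "G \<in> sets (borel \<Otimes>\<^sub>M MJ)"
    unfolding G_def MJ_def
    by (intro sets.sets_Collect_finite_All sets.sets_Collect_neg sets_near_return_law) (auto simp: J_def)
  have R: "(\<Sum>k=1..m. R \<omega> (Inl k)) = increment 0 m \<omega>" "R \<omega> (Inr m) = Y m \<omega>" if "m \<in> {1..n}" for m \<omega>
    unfolding R_def by (rule sum_restrict_XY, use that in \<open>auto simp: J_def\<close>)+
  have sp: "R \<omega> \<in> space MJ" for \<omega> by (simp add: R_def MJ_def space_PiM)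
  have iff: "(y, R \<omega>) \<in> G \<longleftrightarrow> (\<forall>m\<in>{1..n}. \<not> (increment 0 m \<omega> = 0 \<and> norm (Y m \<omega> - y) < \<epsilon>))" for y \<omega>
    unfolding G_def using sp by (simp add: R space_pair_measure del: One_nat_def)
  have "prob {\<omega>\<in>space P. (Y 0 \<omega>, R \<omega>) \<in> G} \<le> 1 / (1 + \<epsilon>\<^sup>2 / 4 * ?g)"
    unfolding R_def
  proof (rule prob_freeze_Y0, fold R_def)
    show "J \<subseteq> {1..} <+> {1..}" by (auto simp: J_def)
    show "G \<in> sets (borel \<Otimes>\<^sub>M Pi\<^sub>M J (\<lambda>_. borel))" using G by (simp add: MJ_def)
    fix y :: "real \<times> real" assume y: "y \<in> {0<..<1} \<times> {0<..<1}"
    let ?p = "measure (distr P borel (Y 0)) (ball y \<epsilon>)"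
    have g0: "?g \<ge> 0" by (intro sum_nonneg) simp
    have p: "\<epsilon>\<^sup>2 / 4 \<le> ?p"
      unfolding law_Y by (rule measure_uniform_unit_square_ball(1)[OF y \<epsilon>])
    have "{\<omega>\<in>space P. (y, R \<omega>) \<in> G} = no_mark (ball y \<epsilon>) 0 n"
      by (simp add: iff no_mark_def dist_norm norm_minus_commute)
    moreover have "1 + \<epsilon>\<^sup>2 / 4 * ?g \<le> 1 + ?p * ?g"
      using mult_right_mono[OF p g0] by simp
    ultimately have "prob {\<omega>\<in>space P. (y, R \<omega>) \<in> G} * (1 + \<epsilon>\<^sup>2 / 4 * ?g) \<le> prob (no_mark (ball y \<epsilon>) 0 n) * (1 + ?p * ?g)"
      by (simp only: mult_left_mono[OF _ measure_nonneg])
    also have "\<dots> \<le> 1" by (rule prob_no_mark_le) simp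
    finally show "prob {\<omega>\<in>space P. (y, R \<omega>) \<in> G} \<le> 1 / (1 + \<epsilon>\<^sup>2 / 4 * ?g)"
      using g0 \<epsilon> by (subst pos_le_divide_eq) (auto intro: add_pos_nonneg)
  qed
  moreover have "{\<omega>\<in>space P. (Y 0 \<omega>, R \<omega>) \<in> G} = {\<omega>\<in>space P. \<forall>m\<in>{1..n}. \<omega> \<notin> near_return \<epsilon> m}"
    by (auto simp: iff near_return_def)
  ultimately show ?thesis by simp
qed

section \<open>Borel-Cantelli along powers of 1/2\<close>

lemma AE_eventually_no_early_near_return:
  "AE \<omega> in P. \<forall>\<^sub>F k in sequentially.
    \<forall>m\<in>{1..nat \<lfloor>exp (4 ^ k / (real k)\<^sup>2)\<rfloor>}. \<omega> \<notin> near_return ((1/2) ^ k) m"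
proof -
  define N where "N = (\<lambda>k. nat \<lfloor>exp (4 ^ k / (real k)\<^sup>2)\<rfloor>)"
  define A where "A = (\<lambda>k. \<Union>m\<in>{1..N k}. near_return ((1/2) ^ k) m)"
  have A: "A k \<in> events" for k unfolding A_def using sets_near_return by auto
  \<comment> \<open>The union bound gives 4 * 4^-k (1 + 4^k/k^2), which is summable thanks to the
    k^2 in the horizon. At \<open>k = 0\<close> division by zero gives 0 on both sides, so that case
    needs no separate treatment.\<close>
  have le: "prob (A k) \<le> 4 * (1/4) ^ k + 4 * inverse ((real k)\<^sup>2)" for k
  proof -
    let ?a = "4 ^ k / (real k)\<^sup>2 :: real"
    let ?e = "(1/2) ^ k :: real"
    have e2: "?e\<^sup>2 = (1/4) ^ k" by (simp add: power2_eq_square flip: power_mult_distrib)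
    have "exp ?a \<ge> 1" by simp
    then have N1: "N k \<ge> 1" unfolding N_def by linarith
    have "real (N k) \<le> exp ?a" unfolding N_def by simp
    then have "ln (real (N k)) \<le> ln (exp ?a)" using N1 by (subst ln_le_cancel_iff) auto
    then have lnN: "ln (real (N k)) \<le> ?a" by simp
    have "prob (A k) \<le> (\<Sum>m=1..N k. prob (near_return ?e m))"
      unfolding A_def using sets_near_return by (intro finite_measure_subadditive_finite) auto
    also have "\<dots> \<le> (\<Sum>m=1..N k. (pm_walk_prob m 0)\<^sup>2 * (4 * ?e\<^sup>2))"
      by (intro sum_mono prob_near_return_le) (auto simp: power_le_one)
    also have "\<dots> = 4 * (1/4) ^ k * (\<Sum>m=1..N k. (pm_walk_prob m 0)\<^sup>2)"
      by (simp add: e2 sum_distrib_right[symmetric])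
    also have "\<dots> \<le> 4 * (1/4) ^ k * (1 + ?a)"
      using sum_pm_walk_prob_sq_le[OF N1] lnN by (intro mult_left_mono) auto
    also have "\<dots> = 4 * (1/4) ^ k + 4 * inverse ((real k)\<^sup>2)"
    proof -
      have "(1/4) ^ k * 4 ^ k = (1::real)" by (simp flip: power_mult_distrib)
      moreover have "4 * (1/4) ^ k * (1 + ?a) = 4 * (1/4) ^ k + 4 * ((1/4) ^ k * 4 ^ k * inverse ((real k)\<^sup>2))"
        by (simp only: divide_inverse[of "4 ^ k"] distrib_left mult.assoc mult_1_right)
      ultimately show ?thesis by simp
    qed
    finally show ?thesis .
  qed
  have "summable (\<lambda>k. prob (A k))"
  proof (rule summable_comparison_test')
    show "summable (\<lambda>k. 4 * (1/4) ^ k + 4 * inverse ((real k)\<^sup>2))"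
      using inverse_power_summable[of 2, where 'a=real]
      by (intro summable_add summable_mult) (auto intro!: summable_geometric)
    show "norm (prob (A k)) \<le> 4 * (1/4) ^ k + 4 * inverse ((real k)\<^sup>2)" if "k \<ge> 0" for k
      using le by simp
  qed
  from borel_cantelli_AE1[OF A _ this]
  have "AE \<omega> in P. \<forall>\<^sub>F k in sequentially. \<omega> \<in> space P - A k"
    by (simp add: less_top[symmetric])
  then show ?thesis
    by eventually_elim (auto elim!: eventually_mono simp: A_def N_def)
qed

text \<open>The horizon \<open>2 * N\<close> suits \<open>sum_pm_walk_prob_sq_ge\<close>: the
  expected number of visits is at least 4^k k^2/4. Multiplied by \<epsilon>^2/4 this is k^2/16,
  whose reciprocal is summable.\<close>

lemma AE_eventually_near_return:
  "AE \<omega> in P. \<forall>\<^sub>F k in sequentially.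
    \<exists>m\<in>{1..2 * nat \<lceil>exp (4 ^ k * (real k)\<^sup>2)\<rceil>}. \<omega> \<in> near_return ((1/2) ^ k) m"
proof -
  define N where "N = (\<lambda>k. nat \<lceil>exp (4 ^ k * (real k)\<^sup>2)\<rceil>)"
  define A where "A = (\<lambda>k. {\<omega>\<in>space P. \<forall>m\<in>{1..2 * N k}. \<omega> \<notin> near_return ((1/2) ^ k) m})"
  have A: "A k \<in> events" for k
  proof -
    have "{\<omega>\<in>space P. \<omega> \<notin> near_return ((1/2) ^ k) m} \<in> events" for m
      using sets.compl_sets[OF sets_near_return] by (simp add: set_diff_eq)
    then show ?thesis unfolding A_def by (intro sets.sets_Collect_finite_All) auto
  qed
  \<comment> \<open>At \<open>k = 0\<close> the right-hand side is 0 by convention and the bound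
    fails.\<close>
  have le: "prob (A k) \<le> 16 * inverse ((real k)\<^sup>2)" if "k \<ge> 1" for k
  proof -
    let ?e = "(1/2) ^ k :: real"
    let ?g = "\<Sum>m=1..2 * N k. (pm_walk_prob m 0)\<^sup>2"
    have e2: "?e\<^sup>2 = (1/4) ^ k" by (simp add: power2_eq_square flip: power_mult_distrib)
    have "exp (4 ^ k * (real k)\<^sup>2) \<le> real (N k) + 1" unfolding N_def by linarith
    then have "4 ^ k * (real k)\<^sup>2 \<le> ln (real (N k) + 1)" by (subst ln_ge_iff) auto
    then have "4 ^ k * (real k)\<^sup>2 / 4 \<le> ?g"
      using sum_pm_walk_prob_sq_ge[of "N k"] by linarith
    then have "(1/4) ^ k / 4 * (4 ^ k * (real k)\<^sup>2 / 4) \<le> ?e\<^sup>2 / 4 * ?g"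
      unfolding e2 by (intro mult_left_mono) auto
    then have "(real k)\<^sup>2 / 16 \<le> ?e\<^sup>2 / 4 * ?g"
      by (simp add: power_one_over)
    then have k: "(real k)\<^sup>2 / 16 \<le> 1 + ?e\<^sup>2 / 4 * ?g" by linarith
    have "prob (A k) \<le> 1 / (1 + ?e\<^sup>2 / 4 * ?g)"
      unfolding A_def by (rule prob_no_near_return_le) (auto simp: power_le_one)
    also have "\<dots> \<le> 1 / ((real k)\<^sup>2 / 16)"
    proof (rule divide_left_mono[OF k])
      have "(real k)\<^sup>2 / 16 > 0" using that by simp
      with k show "0 < (1 + ?e\<^sup>2 / 4 * ?g) * ((real k)\<^sup>2 / 16)"
        by (intro mult_pos_pos) linarith+
    qed simp
    finally show ?thesis by (simp add: inverse_eq_divide)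
  qed
  have "summable (\<lambda>k. prob (A k))"
  proof (rule summable_comparison_test'[of _ 1])
    show "summable (\<lambda>k. 16 * inverse ((real k)\<^sup>2))"
      using inverse_power_summable[of 2, where 'a=real] by (intro summable_mult) auto
    show "norm (prob (A k)) \<le> 16 * inverse ((real k)\<^sup>2)" if "k \<ge> 1" for k
      using le[OF that] by simp
  qed
  from borel_cantelli_AE1[OF A _ this]
  have "AE \<omega> in P. \<forall>\<^sub>F k in sequentially. \<omega> \<in> space P - A k"
    by (simp add: less_top[symmetric])
  then show ?thesis
    by eventually_elim (auto elim!: eventually_mono simp: A_def N_def)
qed

section \<open>Return times of the perturbed walk\<close>

lemma near_return_imp_return_times:
  "m \<ge> 1 \<Longrightarrow> \<omega> \<in> near_return \<epsilon> m \<Longrightarrow> m \<in> return_times X Y \<epsilon> \<omega>"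
  by (simp add: near_return_def return_times_def pert_walk_def increment_0 walk_def)

text \<open>Both \<open>Y m\<close> and the perturbed position lie in the open unit square, so the
  coordinates of the walk are less than 1 in absolute value; being integers, they vanish.\<close>

lemma return_times_imp_near_return:
  assumes m: "m \<in> return_times X Y \<epsilon> \<omega>" and \<omega>: "\<omega> \<in> space P"
    and d: "ball (Y 0 \<omega>) \<epsilon> \<subseteq> {0<..<1} \<times> {0<..<1}"
    and Y: "Y m \<omega> \<in> {0<..<1} \<times> {0<..<1}"
    and walk: "fst (walk X m \<omega>) \<in> \<int>" "snd (walk X m \<omega>) \<in> \<int>"
  shows "\<omega> \<in> near_return \<epsilon> m"
proof -
  have n: "norm (walk X m \<omega> + Y m \<omega> - Y 0 \<omega>) < \<epsilon>"
    using m by (simp add: return_times_def pert_walk_def walk_def)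
  then have "walk X m \<omega> + Y m \<omega> \<in> ball (Y 0 \<omega>) \<epsilon>"
    by (simp add: dist_norm norm_minus_commute)
  with d have "walk X m \<omega> + Y m \<omega> \<in> {0<..<1} \<times> {0<..<1}" by blast
  then have "\<bar>fst (walk X m \<omega>)\<bar> < 1" "\<bar>snd (walk X m \<omega>)\<bar> < 1"
    using Y by (auto simp: mem_Times_iff)
  then have "walk X m \<omega> = 0"
    using walk Ints_nonzero_abs_less1 by (auto simp: prod_eq_iff)
  with n \<omega> show ?thesis by (simp add: near_return_def increment_0)
qed

lemma ret_time_le: "m \<in> return_times X Y \<epsilon> \<omega> \<Longrightarrow> ret_time X Y \<epsilon> \<omega> \<le> m"
  unfolding ret_time_def by (rule Least_le)

lemma ret_time_in: "return_times X Y \<epsilon> \<omega> \<noteq> {} \<Longrightarrow> ret_time X Y \<epsilon> \<omega> \<in> return_times X Y \<epsilon> \<omega>"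
  unfolding ret_time_def by (rule LeastI_ex) blast

text \<open>Only countably many almost sure statements enter, so one null set serves all \<epsilon>;
  the rest of the argument is pathwise.\<close>

lemma AE_loglog_ret_time:
  "AE \<omega> in P. (\<forall>\<epsilon>>0. return_times X Y \<epsilon> \<omega> \<noteq> {}) \<and>
    ((\<lambda>\<epsilon>. ln (ln (real (ret_time X Y \<epsilon> \<omega>))) / (- ln \<epsilon>)) \<longlongrightarrow> 2) (at_right 0)"
proof -
  have "AE \<omega> in P. \<forall>k. Y k \<omega> \<in> {0<..<1} \<times> {0<..<1}"
    using AE_Y_square by (subst AE_all_countable) blast
  from this AE_walk_Ints AE_eventually_no_early_near_return AE_eventually_near_return AE_space
  show ?thesis
  proof eventually_elim
    case (elim \<omega>)
    have mono: "return_times X Y \<epsilon> \<omega> \<subseteq> return_times X Y \<epsilon>' \<omega>" if "\<epsilon> \<le> \<epsilon>'" for \<epsilon> \<epsilon>'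
      using that by (auto simp: return_times_def)
    have ev: "\<forall>\<^sub>F k in sequentially. \<exists>m\<in>return_times X Y ((1/2) ^ k) \<omega>. m \<le> 2 * nat \<lceil>exp (4 ^ k * (real k)\<^sup>2)\<rceil>"
      using elim(4)
    proof eventually_elim
      case (elim k)
      then show ?case using near_return_imp_return_times by (meson atLeastAtMost_iff)
    qed
    have to0: "(\<lambda>k. (1/2) ^ k) \<longlonglongrightarrow> (0::real)" by (rule LIMSEQ_power_zero) simp
    \<comment> \<open>Return times exist for all large \<open>k\<close>, and the sets of return
      times grow with \<epsilon>.\<close>
    have ne: "return_times X Y \<epsilon> \<omega> \<noteq> {}" if "\<epsilon> > 0" for \<epsilon>
    proof -
      have "\<forall>\<^sub>F k in sequentially. (1/2) ^ k < \<epsilon>"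
        using order_tendstoD(2)[OF to0 that] .
      then obtain k where "(1/2) ^ k < \<epsilon>" "return_times X Y ((1/2) ^ k) \<omega> \<noteq> {}"
        using eventually_happens[OF eventually_conj[OF _ ev]] by fastforce
      then show ?thesis using mono[of "(1/2) ^ k" \<epsilon>] by auto
    qed
    have "open ({0<..<1} \<times> {0<..<1} :: (real \<times> real) set)" by (intro open_Times) auto
    then obtain d where d: "d > 0" "ball (Y 0 \<omega>) d \<subseteq> {0<..<1} \<times> {0<..<1}"
      using elim(1) open_contains_ball by blast
    have "((\<lambda>\<epsilon>. ln (ln (real (ret_time X Y \<epsilon> \<omega>))) / (- ln \<epsilon>)) \<longlongrightarrow> 2) (at_right 0)"
    proof (rule loglog_tendsto_2I)
      show "ret_time X Y \<epsilon>' \<omega> \<le> ret_time X Y \<epsilon> \<omega>" if "0 < \<epsilon>" "\<epsilon> \<le> \<epsilon>'" for \<epsilon> \<epsilon>'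
        using ret_time_in[OF ne[OF that(1)]] mono[OF that(2)] by (intro ret_time_le) blast
      show "\<forall>\<^sub>F k in sequentially. exp (4 ^ k / (real k)\<^sup>2) < real (ret_time X Y ((1/2) ^ k) \<omega>)"
        using elim(3) order_tendstoD(2)[OF to0 d(1)]
      proof eventually_elim
        case k: (elim k)
        let ?m = "ret_time X Y ((1/2) ^ k) \<omega>"
        have m: "?m \<in> return_times X Y ((1/2) ^ k) \<omega>" by (intro ret_time_in ne) simp
        have "ball (Y 0 \<omega>) ((1/2) ^ k) \<subseteq> {0<..<1} \<times> {0<..<1}"
          using d(2) k(2) subset_ball[of "(1/2) ^ k" d "Y 0 \<omega>"] by auto
        then have "\<omega> \<in> near_return ((1/2) ^ k) ?m"
          using elim(1,2,5) by (intro return_times_imp_near_return[OF m]) auto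
        then have "?m \<notin> {1..nat \<lfloor>exp (4 ^ k / (real k)\<^sup>2)\<rfloor>}" using k(1) by blast
        moreover have "?m \<ge> 1" using m by (simp add: return_times_def)
        \<comment> \<open>A natural number above the floor of a real exceeds the real itself, which
          gives the strict bound.\<close>
        ultimately have "nat \<lfloor>exp (4 ^ k / (real k)\<^sup>2)\<rfloor> < ?m" by simp
        then show ?case by linarith
      qed
      show "\<forall>\<^sub>F k in sequentially. real (ret_time X Y ((1/2) ^ k) \<omega>) \<le> 2 * exp (4 ^ k * (real k)\<^sup>2) + 2"
        using ev
      proof eventually_elim
        case (elim k)
        then obtain m where m: "m \<in> return_times X Y ((1/2) ^ k) \<omega>" "m \<le> 2 * nat \<lceil>exp (4 ^ k * (real k)\<^sup>2)\<rceil>"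
          by blast
        let ?x = "exp (4 ^ k * (real k)\<^sup>2)"
        have "ret_time X Y ((1/2) ^ k) \<omega> \<le> 2 * nat \<lceil>?x\<rceil>"
          using ret_time_le[OF m(1)] m(2) by linarith
        then have "real (ret_time X Y ((1/2) ^ k) \<omega>) \<le> 2 * real (nat \<lceil>?x\<rceil>)"
          by linarith
        moreover have "real (nat \<lceil>?x\<rceil>) \<le> ?x + 1"
          using exp_gt_zero[of "4 ^ k * (real k)\<^sup>2"] by linarith
        ultimately show ?case by linarith
      qed
    qed
    with ne show ?case by blast
  qed
qed

end

theorem theorem1:
  fixes P :: "'a measure" and X Y :: "nat \<Rightarrow> 'a \<Rightarrow> real \<times> real"
  assumes "prob_space P"
    and "iid P {1..} X"
    and "iid P UNIV Y"
    and "prob_space.indep_var P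
      (Pi\<^sub>M {1..} (\<lambda>_. borel)) (\<lambda>\<omega>. \<lambda>n\<in>{1..}. X n \<omega>)
      (Pi\<^sub>M UNIV (\<lambda>_. borel)) (\<lambda>\<omega> n. Y n \<omega>)"
    and "distr P borel (X 1) =
      distr (uniform_count_measure {(1, 0), (-1, 0), (0, 1), (0, -1)}) borel (\<lambda>x. x)"
    and "distr P borel (Y 0) = uniform_measure lborel ({0<..<1} \<times> {0<..<1})"
  shows "AE \<omega> in P.
    (\<forall>\<epsilon>>0. return_times X Y \<epsilon> \<omega> \<noteq> {}) \<and>
    ((\<lambda>\<epsilon>. ln (ln (real (ret_time X Y \<epsilon> \<omega>))) / (- ln \<epsilon>)) \<longlongrightarrow> 2) (at_right 0)"
proof -
  have "perturbed_walk P X Y"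
    by (intro perturbed_walk.intro perturbed_walk_axioms.intro assms)
  then show ?thesis by (rule perturbed_walk.AE_loglog_ret_time)
qed

end
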